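(* Let $M$ be a connected two-dimensional manifold and $f,\widehat f:M\to\mathbb{R}^3$ non-degenerate immersions endowed with equiaffine transversal vector fields $\xi$ and $\widehat\xi$, with affine fundamental forms $h,\widehat h$, induced volume forms $\theta,\widehat\theta$, conormal maps $\nu,\widehat\nu$ and induced connections $\nabla,\widehat\nabla$ with curvature tensors $R,\widehat R$. Assume: 1° for every $p$, $f(p)\ne\widehat f(p)$ and $\widehat f(p)-f(p)$ lies in both $f_*(T_pM)$ and $\widehat f_*(T_pM)$; 2° the map $p\mapsto\pi(\widehat f(p)-f(p))\in\mathbb{P}^2(\mathbb{R})$ has rank $2$ everywhere; 3° $\det(\widehat f-f,\xi,\widehat\xi)\ne0$ everywhere; 4° $\nu(\widehat\xi)$ and $\widehat\nu(\xi)$ are constant, and $\nu(\widehat\xi)\ne0$ or $\widehat\nu(\xi)\ne0$; 5° $\big(\det(\widehat f-f,\xi,\widehat\xi)\big)^4\det_\theta h\,\det_{\widehat\theta}\widehat h=\big(1-\nu(\widehat\xi)\widehat\nu(\xi)\big)^4$; 6° $\det(f_*Y,\xi,\widehat\xi)=\det(\widehat f_*Y,\xi,\widehat\xi)$ for all $Y\in TM$; 7° $d\big(\det(\widehat f-f,\xi,\widehat\xi)\big)\wedge d(\det_\theta h)=0$. Assume moreover $\dim\operatorname{im}R=\dim\operatorname{im}\widehat R=2$. Then $\det(\widehat f-f,\xi,\widehat\xi)$ and $\det_\theta h$ are constant, the lines $\mathbb{R}\xi$ and $\mathbb{R}\widehat\xi$ are the affine normal lines of $f$ and $\widehat f$ respectively,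 and there exists a scalar product or pseudo-scalar product (a non-degenerate symmetric bilinear form, possibly indefinite) on $\mathbb{R}^3$ with respect to which $\xi$ and $\widehat\xi$ are orthogonal to the corresponding surfaces and have constant non-zero length. Moreover, with respect to this product the length of $\widehat f-f$ is constant, the angle between $\xi$ and $\widehat\xi$ is constant, and the metrics induced on $M$ by $f$ and $\widehat f$ have the same constant sectional curvature.
   Context: $\mathbb{R}^3$ carries its standard flat connection $D$ and the standard determinant. For an immersion $f$ with transversal field $\xi$: $D_Xf_*Y=f_*(\nabla_XY)+h(X,Y)\xi$, $D_X\xi=-f_*(SX)+\tau(X)\xi$; $\xi$ is equiaffine if $\tau=0$. $\theta(X,Y)=\det(f_*X,f_*Y,\xi)$; $\det_\theta h=\det[h(X_i,X_j)]$ for a basis with $\theta(X_1,X_2)=1$. The conormal map $\nu$ satisfies $\nu(f_*X)=0$, $\nu(\xi)=1$. The affine (Blaschke) normal of a non-degenerate surface is the transversal field, unique up to sign, with $\tau=0$ and $|\det_\theta h|=1$. $\pi$ is the canonical projection $\mathbb{R}^3\setminus\{0\}\to\mathbb{P}^2(\mathbb{R})$. $\operatorname{im}R$ at $p$ is the span of $\{R(X,Y)Z:X,Y,Z\in T_pM\}$. Angles in the pseudo-Euclidean case are understood as (hyperbolic) angles between vectors in Minkowski space. *)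

theory Defs
  imports "HOL-Analysis.Analysis"
begin

definition det3 :: "real^3 \<Rightarrow> real^3 \<Rightarrow> real^3 \<Rightarrow> real" where
  "det3 a b c = det (vector [a, b, c] :: real^3^3)"

definition bform :: "real^3^3 \<Rightarrow> real^3 \<Rightarrow> real^3 \<Rightarrow> real" where
  "bform Q u v = u \<bullet> (Q *v v)"

definition pseudo_scalar_product :: "real^3^3 \<Rightarrow> bool" where
  "pseudo_scalar_product Q \<longleftrightarrow> transpose Q = Q \<and> det Q \<noteq> 0"

definition pd :: "(real^2 \<Rightarrow> 'a::real_normed_vector) \<Rightarrow> 2 \<Rightarrow> real^2 \<Rightarrow> 'a" where
  "pd F i x = frechet_derivative F (at x) (axis i 1)"

fun dpart :: "2 list \<Rightarrow> (real^2 \<Rightarrow> 'a::real_normed_vector) \<Rightarrow> real^2 \<Rightarrow> 'a" where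
  "dpart [] F = F"
| "dpart (i # is) F = pd (dpart is F) i"

definition smooth_on :: "(real^2 \<Rightarrow> 'a::real_normed_vector) \<Rightarrow> (real^2) set \<Rightarrow> bool" where
  "smooth_on F V \<longleftrightarrow> (\<forall>is. \<forall>x\<in>V. dpart is F differentiable (at x))"

type_synonym 'm chart = "'m set \<times> ('m \<Rightarrow> real^2)"

definition is_chart :: "'m::topological_space set \<Rightarrow> ('m \<Rightarrow> real^2) \<Rightarrow> bool" where
  "is_chart U \<phi> \<longleftrightarrow> open U \<and> open (\<phi> ` U) \<and> homeomorphism U (\<phi> ` U) \<phi> (inv_into U \<phi>)"

definition cdom :: "'m chart \<Rightarrow> (real^2) set" where
  "cdom c = snd c ` fst c"

definition loc :: "'m chart \<Rightarrow> ('m \<Rightarrow> 'a) \<Rightarrow> real^2 \<Rightarrow> 'a" where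
  "loc c g = g \<circ> inv_into (fst c) (snd c)"

definition smooth_atlas :: "'m::topological_space chart set \<Rightarrow> bool" where
  "smooth_atlas A \<longleftrightarrow> (\<forall>c\<in>A. is_chart (fst c) (snd c)) \<and> \<Union>(fst ` A) = UNIV \<and>
     (\<forall>c\<in>A. \<forall>c'\<in>A. smooth_on (snd c' \<circ> inv_into (fst c) (snd c)) (snd c ` (fst c \<inter> fst c')))"

definition smooth_map :: "'m chart set \<Rightarrow> ('m \<Rightarrow> 'a::real_normed_vector) \<Rightarrow> bool" where
  "smooth_map A g \<longleftrightarrow> (\<forall>c\<in>A. smooth_on (loc c g) (cdom c))"

definition immersion :: "'m chart set \<Rightarrow> ('m \<Rightarrow> real^3) \<Rightarrow> bool" where
  "immersion A f \<longleftrightarrow> smooth_map A f \<and>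
     (\<forall>c\<in>A. \<forall>x\<in>cdom c. dim (range (frechet_derivative (loc c f) (at x))) = 2)"

text \<open>F = local expression of f, X = local expression of the transversal field xi.\<close>

definition vol :: "(real^2 \<Rightarrow> real^3) \<Rightarrow> (real^2 \<Rightarrow> real^3) \<Rightarrow> real^2 \<Rightarrow> real" where
  "vol F X x = det3 (pd F 1 x) (pd F 2 x) (X x)"

text \<open>Conormal map nu at the point x: nu(f_* Y) = 0, nu(xi) = 1.\<close>
definition conormal :: "(real^2 \<Rightarrow> real^3) \<Rightarrow> (real^2 \<Rightarrow> real^3) \<Rightarrow> real^2 \<Rightarrow> real^3 \<Rightarrow> real" where
  "conormal F X x w = det3 (pd F 1 x) (pd F 2 x) w / vol F X x"

definition afh :: "(real^2 \<Rightarrow> real^3) \<Rightarrow> (real^2 \<Rightarrow> real^3) \<Rightarrow> 2 \<Rightarrow> 2 \<Rightarrow> real^2 \<Rightarrow> real" where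
  "afh F X i j x = conormal F X x (pd (pd F j) i x)"

definition tau :: "(real^2 \<Rightarrow> real^3) \<Rightarrow> (real^2 \<Rightarrow> real^3) \<Rightarrow> 2 \<Rightarrow> real^2 \<Rightarrow> real" where
  "tau F X i x = conormal F X x (pd X i x)"

text \<open>Christoffel symbols of the induced connection: nabla_{d_i} d_j = sum_k christ k i j d_k.\<close>
definition christ :: "(real^2 \<Rightarrow> real^3) \<Rightarrow> (real^2 \<Rightarrow> real^3) \<Rightarrow> 2 \<Rightarrow> 2 \<Rightarrow> 2 \<Rightarrow> real^2 \<Rightarrow> real" where
  "christ F X k i j x =
     (if k = 1 then det3 (pd (pd F j) i x) (pd F 2 x) (X x)
      else det3 (pd F 1 x) (pd (pd F j) i x) (X x)) / vol F X x"

definition deth :: "(real^2 \<Rightarrow> real^3) \<Rightarrow> (real^2 \<Rightarrow> real^3) \<Rightarrow> real^2 \<Rightarrow> real" where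
  "deth F X x = afh F X 1 1 x * afh F X 2 2 x - afh F X 1 2 x * afh F X 2 1 x"

definition det_theta_h :: "(real^2 \<Rightarrow> real^3) \<Rightarrow> (real^2 \<Rightarrow> real^3) \<Rightarrow> real^2 \<Rightarrow> real" where
  "det_theta_h F X x = deth F X x / (vol F X x)^2"

text \<open>Curvature of a connection with Christoffel symbols G (G k i j = Gamma^k_{ij}):
  R(d_i,d_j) d_k = sum_l curv G l k i j d_l, where R(X,Y) = [nabla_X,nabla_Y] - nabla_[X,Y].\<close>
definition curv :: "(2 \<Rightarrow> 2 \<Rightarrow> 2 \<Rightarrow> real^2 \<Rightarrow> real) \<Rightarrow> 2 \<Rightarrow> 2 \<Rightarrow> 2 \<Rightarrow> 2 \<Rightarrow> real^2 \<Rightarrow> real" where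
  "curv G l k i j x = pd (G l j k) i x - pd (G l i k) j x
     + (\<Sum>m\<in>UNIV. G m j k x * G l i m x - G m i k x * G l j m x)"

definition dim_im_curv :: "(2 \<Rightarrow> 2 \<Rightarrow> 2 \<Rightarrow> real^2 \<Rightarrow> real) \<Rightarrow> real^2 \<Rightarrow> nat" where
  "dim_im_curv G x = dim {(\<chi> l. curv G l k i j x) | i j k. True}"

definition equiaffine_transversal :: "'m chart set \<Rightarrow> ('m \<Rightarrow> real^3) \<Rightarrow> ('m \<Rightarrow> real^3) \<Rightarrow> bool" where
  "equiaffine_transversal A f \<xi> \<longleftrightarrow> smooth_map A \<xi> \<and>
     (\<forall>c\<in>A. \<forall>x\<in>cdom c. vol (loc c f) (loc c \<xi>) x \<noteq> 0 \<and> (\<forall>i. tau (loc c f) (loc c \<xi>) i x = 0))"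

definition nondegenerate :: "'m chart set \<Rightarrow> ('m \<Rightarrow> real^3) \<Rightarrow> ('m \<Rightarrow> real^3) \<Rightarrow> bool" where
  "nondegenerate A f \<xi> \<longleftrightarrow> (\<forall>c\<in>A. \<forall>x\<in>cdom c. deth (loc c f) (loc c \<xi>) x \<noteq> 0)"

definition affine_normal :: "'m chart set \<Rightarrow> ('m \<Rightarrow> real^3) \<Rightarrow> ('m \<Rightarrow> real^3) \<Rightarrow> bool" where
  "affine_normal A f \<eta> \<longleftrightarrow> equiaffine_transversal A f \<eta> \<and>
     (\<forall>c\<in>A. \<forall>x\<in>cdom c. \<bar>det_theta_h (loc c f) (loc c \<eta>) x\<bar> = 1)"

definition dd :: "('m \<Rightarrow> real^3) \<Rightarrow> ('m \<Rightarrow> real^3) \<Rightarrow> ('m \<Rightarrow> real^3) \<Rightarrow> ('m \<Rightarrow> real^3) \<Rightarrow> 'm \<Rightarrow> real" where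
  "dd f fh \<xi> \<xi>h p = det3 (fh p - f p) (\<xi> p) (\<xi>h p)"

definition indmet :: "real^3^3 \<Rightarrow> (real^2 \<Rightarrow> real^3) \<Rightarrow> 2 \<Rightarrow> 2 \<Rightarrow> real^2 \<Rightarrow> real" where
  "indmet Q F i j x = bform Q (pd F i x) (pd F j x)"

definition indmet_det :: "real^3^3 \<Rightarrow> (real^2 \<Rightarrow> real^3) \<Rightarrow> real^2 \<Rightarrow> real" where
  "indmet_det Q F x = indmet Q F 1 1 x * indmet Q F 2 2 x - indmet Q F 1 2 x * indmet Q F 2 1 x"

definition lc_christ :: "real^3^3 \<Rightarrow> (real^2 \<Rightarrow> real^3) \<Rightarrow> 2 \<Rightarrow> 2 \<Rightarrow> 2 \<Rightarrow> real^2 \<Rightarrow> real" where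
  "lc_christ Q F k i j x =
     (\<Sum>l\<in>UNIV. matrix_inv (\<chi> a b. indmet Q F a b x) $ k $ l *
        (pd (indmet Q F j l) i x + pd (indmet Q F i l) j x - pd (indmet Q F i j) l x)) / 2"

text \<open>Sectional curvature g(R(d1,d2)d2,d1) / (g11 g22 - g12^2).\<close>
definition sect_curv :: "real^3^3 \<Rightarrow> (real^2 \<Rightarrow> real^3) \<Rightarrow> real^2 \<Rightarrow> real" where
  "sect_curv Q F x =
     (\<Sum>l\<in>UNIV. curv (lc_christ Q F) l 2 1 2 x * indmet Q F l 1 x) / indmet_det Q F x"

end

theory Submission
  imports Defs
begin

text \<open>
  Put \<open>W = fh - f\<close>. By the third assumption \<open>(W, \<xi>, \<xi>h)\<close> is a moving frame, and with the constants
  \<open>a = \<nu>(\<xi>h)\<close>, \<open>b = \<nu>h(\<xi>)\<close> tangency, equiaffinity and the sixth assumption give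
  \<open>df = \<alpha> W + \<beta> (\<xi>h - a \<xi>)\<close>, \<open>dfh = \<alpha> W + \<gamma> (\<xi> - b \<xi>h)\<close>, \<open>d\<xi> = \<mu> W + \<lambda> (\<xi>h - a \<xi>)\<close>,
  \<open>d\<xi>h = \<rho> W + \<sigma> (\<xi> - b \<xi>h)\<close>. The rank condition says that \<open>(1 - a b) \<beta> \<and> \<gamma>\<close> vanishes nowhere.
  The integrability conditions together with the fifth assumption yield \<open>\<sigma> = t \<lambda>\<close>, hence
  \<open>\<mu> = m \<gamma>\<close>, \<open>\<rho> \<parallel> \<beta>\<close>, and \<open>d log det(W, \<xi>, \<xi>h) = - (a + b t) \<lambda>\<close>, where
  \<open>det\<^sub>\<theta> h = (1 - a b)\<^sup>2 t / det(W, \<xi>, \<xi>h)\<^sup>2\<close>. By the seventh assumption \<open>(a + b t) m = 0\<close>; the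
  image of the curvature being two-dimensional forces \<open>m \<noteq> 0\<close>, so \<open>t = - a / b\<close> is constant. The
  structure equations then give \<open>dm = 0\<close>, and the form with \<open>W\<close> orthogonal to \<open>\<xi>\<close>, \<open>\<xi>h\<close> and
  \<open>Q(\<xi>,\<xi>) : Q(\<xi>,\<xi>h) : Q(\<xi>h,\<xi>h) = b : a b : a\<close>, \<open>Q(W,W) = - 1 / m\<close>, has constant coefficients in
  three-space. Both sectional curvatures are \<open>- (1 - a b) / Q(W,W)\<close>.
\<close>

section \<open>Partial derivatives and the symmetry of second derivatives\<close>

lemma pd_eqI: "(F has_derivative F') (at x) \<Longrightarrow> pd F i x = F' (axis i 1)"
  by (metis frechet_derivative_at pd_def)

lemma frechet_derivative_eq_pd:
  fixes F :: "real^2 \<Rightarrow> 'a::real_normed_vector"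
  assumes "F differentiable (at x)"
  shows "frechet_derivative F (at x) v = v $ 1 *\<^sub>R pd F 1 x + v $ 2 *\<^sub>R pd F 2 x"
proof -
  have lin: "linear (frechet_derivative F (at x))"
    using assms linear_frechet_derivative by blast
  have v: "v = v $ 1 *\<^sub>R axis 1 1 + v $ 2 *\<^sub>R axis 2 1"
    by (simp add: vec_eq_iff forall_2 axis_def)
  show ?thesis
    unfolding pd_def
    by (subst v) (simp only: linear_add[OF lin] linear_scale[OF lin])
qed

text \<open>\<open>frechet_derivative\<close> is a choice from the set of derivatives at
  \<open>x\<close>. Functions that agree near \<open>x\<close> have the same set, so the choices
  coincide even where no derivative exists.\<close>

lemma pd_cong:
  assumes "open V" "x \<in> V" "\<And>y. y \<in> V \<Longrightarrow> F y = G y"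
  shows "pd F i x = pd G i x"
proof -
  have "(F has_derivative F') (at x) \<longleftrightarrow> (G has_derivative F') (at x)" for F'
    using has_derivative_transform_within_open[of F F' x UNIV V G]
      has_derivative_transform_within_open[of G F' x UNIV V F] assms by auto
  then show ?thesis
    by (simp add: pd_def frechet_derivative_def)
qed

lemma differentiable_cong_open:
  assumes "open V" "x \<in> V" "\<And>y. y \<in> V \<Longrightarrow> F y = G y" "G differentiable (at x)"
  shows "F differentiable (at x)"
  using assms has_derivative_transform_within_open[of G _ x UNIV V F]
  unfolding differentiable_def by metis

lemma pd_const: "pd (\<lambda>y. c) i x = 0"
  by (rule pd_eqI[of _ "\<lambda>h. 0", simplified]) simp

lemma differentiable_hd: "F differentiable (at x) \<Longrightarrow> (F has_derivative frechet_derivative F (at x)) (at x)"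
  using frechet_derivative_works by blast

lemma pd_add:
  "F differentiable (at x) \<Longrightarrow> G differentiable (at x) \<Longrightarrow> pd (\<lambda>y. F y + G y) i x = pd F i x + pd G i x"
  unfolding pd_def[of F] pd_def[of G]
  by (rule pd_eqI) (intro derivative_intros differentiable_hd)

lemma pd_diff:
  "F differentiable (at x) \<Longrightarrow> G differentiable (at x) \<Longrightarrow> pd (\<lambda>y. F y - G y) i x = pd F i x - pd G i x"
  unfolding pd_def[of F] pd_def[of G]
  by (rule pd_eqI) (intro derivative_intros differentiable_hd)

lemma pd_minus: "F differentiable (at x) \<Longrightarrow> pd (\<lambda>y. - F y) i x = - pd F i x"
  unfolding pd_def[of F]
  by (rule pd_eqI) (intro derivative_intros differentiable_hd)

lemma pd_linear:
  assumes "bounded_linear L" "F differentiable (at x)"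
  shows "pd (\<lambda>y. L (F y)) i x = L (pd F i x)"
  unfolding pd_def[of F]
  by (rule pd_eqI) (intro bounded_linear.has_derivative[OF assms(1)] differentiable_hd assms)

lemma pd_bilinear:
  assumes "bounded_bilinear B" "F differentiable (at x)" "G differentiable (at x)"
  shows "pd (\<lambda>y. B (F y) (G y)) i x = B (F x) (pd G i x) + B (pd F i x) (G x)"
  unfolding pd_def[of F] pd_def[of G]
  by (rule pd_eqI) (intro bounded_bilinear.FDERIV[OF assms(1)] differentiable_hd assms)

lemma bilinear_differentiable:
  assumes "bounded_bilinear B" "F differentiable (at x)" "G differentiable (at x)"
  shows "(\<lambda>y. B (F y) (G y)) differentiable (at x)"
  using bounded_bilinear.FDERIV[OF assms(1) differentiable_hd[OF assms(2)] differentiable_hd[OF assms(3)]]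
  by (rule differentiableI)

lemma linear_differentiable:
  assumes "bounded_linear L" "F differentiable (at x)"
  shows "(\<lambda>y. L (F y)) differentiable (at x)"
  using bounded_linear.has_derivative[OF assms(1) differentiable_hd[OF assms(2)]]
  by (rule differentiableI)

lemmas pd_scaleR = pd_bilinear[OF bounded_bilinear_scaleR]
lemmas pd_mult = pd_bilinear[OF bounded_bilinear_mult]
lemmas pd_vec_nth = pd_linear[OF bounded_linear_vec_nth]
lemmas scaleR_differentiable = bilinear_differentiable[OF bounded_bilinear_scaleR]
lemmas vec_nth_differentiable = linear_differentiable[OF bounded_linear_vec_nth]

lemma pd_divide:
  fixes u v :: "real^2 \<Rightarrow> real"
  assumes "u differentiable (at x)" "v differentiable (at x)" "v x \<noteq> 0"
  shows "pd (\<lambda>y. u y / v y) i x = (pd u i x * v x - u x * pd v i x) / (v x)^2"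
proof -
  have "((\<lambda>y. u y / v y) has_derivative
      (\<lambda>h. (frechet_derivative u (at x) h * v x - u x * frechet_derivative v (at x) h) / (v x * v x))) (at x)"
    by (intro has_derivative_divide' differentiable_hd assms)
  from pd_eqI[OF this] show ?thesis
    by (simp add: pd_def power2_eq_square)
qed

lemma pd_scaleR_const:
  fixes c :: real
  assumes "F differentiable (at x)"
  shows "pd (\<lambda>y. c *\<^sub>R F y) i x = c *\<^sub>R pd F i x"
  by (rule pd_linear[OF bounded_linear_scaleR_right assms])

text \<open>The mean value theorem is used twice: in direction \<open>i\<close> for the difference
  of \<open>g\<close> along two opposite sides of a square of side \<open>h\<close>, then in
  direction \<open>j\<close> for \<open>pd g i\<close>. Displacements inside the square have norm at
  most 2h, hence the radius \<open>3 * h\<close>.\<close>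

lemma second_difference_eq_pd:
  fixes g :: "real^2 \<Rightarrow> real"
  assumes ball: "ball x (3 * h) \<subseteq> V" and h: "0 < h"
    and g: "\<And>y. y \<in> V \<Longrightarrow> g differentiable (at y)"
    and gi: "\<And>y. y \<in> V \<Longrightarrow> pd g i differentiable (at y)"
  shows "\<exists>p\<in>ball x (3 * h). g (x + h *\<^sub>R axis i 1 + h *\<^sub>R axis j 1) - g (x + h *\<^sub>R axis i 1)
      - g (x + h *\<^sub>R axis j 1) + g x = h^2 * pd (pd g i) j p"
proof -
  let ?e = "axis i 1 :: real^2" and ?f = "axis j 1 :: real^2"
  have inB: "x + s *\<^sub>R ?e + t *\<^sub>R ?f \<in> ball x (3 * h)"
    if "0 \<le> s" "s \<le> h" "0 \<le> t" "t \<le> h" for s t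
  proof -
    have "norm (s *\<^sub>R ?e + t *\<^sub>R ?f) \<le> norm (s *\<^sub>R ?e) + norm (t *\<^sub>R ?f)"
      by (rule norm_triangle_ineq)
    also have "\<dots> < 3 * h" using that h by (simp add: norm_axis_1)
    finally show ?thesis
      by (metis add.assoc add_diff_cancel_left' dist_norm mem_ball dist_commute)
  qed
  have along: "((\<lambda>s. u (z + s *\<^sub>R axis k 1)) has_field_derivative pd u k (z + s *\<^sub>R axis k 1)) (at s)"
    if "u differentiable (at (z + s *\<^sub>R axis k 1))" for u :: "real^2 \<Rightarrow> real" and z k s
  proof -
    let ?D = "frechet_derivative u (at (z + s *\<^sub>R axis k 1))"
    have 1: "((\<lambda>s. z + s *\<^sub>R axis k 1) has_derivative (\<lambda>t. t *\<^sub>R axis k 1)) (at s)"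
      by (auto intro!: derivative_eq_intros)
    have 2: "((\<lambda>s. u (z + s *\<^sub>R axis k 1)) has_derivative (\<lambda>t. ?D (t *\<^sub>R axis k 1))) (at s)"
      using has_derivative_compose[OF 1 differentiable_hd[OF that]] .
    have "linear ?D" using that linear_frechet_derivative by blast
    then have "(\<lambda>t. ?D (t *\<^sub>R axis k 1)) = (*) (pd u k (z + s *\<^sub>R axis k 1))"
      by (simp add: fun_eq_iff pd_def linear_scale)
    then show ?thesis using 2 by (simp add: has_field_derivative_def)
  qed
  let ?\<phi> = "\<lambda>s. g ((x + h *\<^sub>R ?f) + s *\<^sub>R ?e) - g (x + s *\<^sub>R ?e)"
  have "\<exists>s>0. s < h \<and> ?\<phi> h - ?\<phi> 0 = (h - 0) *
      (pd g i ((x + h *\<^sub>R ?f) + s *\<^sub>R ?e) - pd g i (x + s *\<^sub>R ?e))"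
  proof (rule MVT2[OF h])
    fix s assume s: "0 \<le> s" "s \<le> h"
    have "(x + h *\<^sub>R ?f) + s *\<^sub>R ?e \<in> V" "x + s *\<^sub>R ?e \<in> V"
      using inB[of s h] inB[of s 0] s h ball by (auto simp: algebra_simps)
    then show "(?\<phi> has_real_derivative
        (pd g i ((x + h *\<^sub>R ?f) + s *\<^sub>R ?e) - pd g i (x + s *\<^sub>R ?e))) (at s)"
      by (intro DERIV_diff along g)
  qed
  then obtain s where s: "0 < s" "s < h" and \<phi>: "?\<phi> h - ?\<phi> 0 = h *
      (pd g i ((x + h *\<^sub>R ?f) + s *\<^sub>R ?e) - pd g i (x + s *\<^sub>R ?e))"
    by auto
  let ?\<psi> = "\<lambda>t. pd g i ((x + s *\<^sub>R ?e) + t *\<^sub>R ?f)"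
  have "\<exists>t>0. t < h \<and> ?\<psi> h - ?\<psi> 0 = (h - 0) * pd (pd g i) j ((x + s *\<^sub>R ?e) + t *\<^sub>R ?f)"
  proof (rule MVT2[OF h])
    fix t assume "0 \<le> t" "t \<le> h"
    then have "(x + s *\<^sub>R ?e) + t *\<^sub>R ?f \<in> V" using inB[of s t] s ball by auto
    then show "(?\<psi> has_real_derivative pd (pd g i) j ((x + s *\<^sub>R ?e) + t *\<^sub>R ?f)) (at t)"
      by (intro along gi)
  qed
  then obtain t where t: "0 < t" "t < h"
    and \<psi>: "?\<psi> h - ?\<psi> 0 = h * pd (pd g i) j ((x + s *\<^sub>R ?e) + t *\<^sub>R ?f)" by auto
  let ?p = "(x + s *\<^sub>R ?e) + t *\<^sub>R ?f"
  have comm: "(x + h *\<^sub>R ?f) + s *\<^sub>R ?e = (x + s *\<^sub>R ?e) + h *\<^sub>R ?f" for s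
    by (simp add: algebra_simps)
  have "?\<phi> h - ?\<phi> 0 = h * (h * pd (pd g i) j ?p)"
    using \<phi> \<psi> unfolding comm by simp
  then have "g (x + h *\<^sub>R ?e + h *\<^sub>R ?f) - g (x + h *\<^sub>R ?e) - g (x + h *\<^sub>R ?f) + g x
      = h^2 * pd (pd g i) j ?p"
    unfolding comm by (simp add: power2_eq_square)
  moreover have "?p \<in> ball x (3 * h)" using inB[of s t] s t by simp
  ultimately show ?thesis by blast
qed

text \<open>The second difference over a square is symmetric in \<open>i\<close> and
  \<open>j\<close>, so the two mixed derivatives take a common value at points \<open>p\<close> and
  \<open>q\<close> arbitrarily close to \<open>x\<close>; continuity carries the equality over to
  \<open>x\<close>.\<close>

lemma mixed_partials_real:
  fixes g :: "real^2 \<Rightarrow> real"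
  assumes V: "open V" "x \<in> V"
    and g: "\<And>y. y \<in> V \<Longrightarrow> g differentiable (at y)"
    and gi: "\<And>y k. y \<in> V \<Longrightarrow> pd g k differentiable (at y)"
    and cont: "\<And>k l. isCont (pd (pd g k) l) x"
  shows "pd (pd g i) j x = pd (pd g j) i x"
proof (rule ccontr)
  assume ne: "pd (pd g i) j x \<noteq> pd (pd g j) i x"
  \<comment> \<open>Half the gap: two values lying strictly within \<open>e\<close> of the two sides
    cannot coincide.\<close>
  define e where "e = \<bar>pd (pd g i) j x - pd (pd g j) i x\<bar> / 2"
  have e: "e > 0" using ne by (simp add: e_def)
  obtain d0 where d0: "d0 > 0" "ball x d0 \<subseteq> V" using V openE by blast
  obtain d1 where d1: "d1 > 0"
    "\<And>y. dist y x < d1 \<Longrightarrow> \<bar>pd (pd g i) j y - pd (pd g i) j x\<bar> < e"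
    using cont[of i j] e unfolding continuous_at_eps_delta dist_real_def by metis
  obtain d2 where d2: "d2 > 0"
    "\<And>y. dist y x < d2 \<Longrightarrow> \<bar>pd (pd g j) i y - pd (pd g j) i x\<bar> < e"
    using cont[of j i] e unfolding continuous_at_eps_delta dist_real_def by metis
  define h where "h = min d0 (min d1 d2) / 3"
  have h: "h > 0" "3 * h \<le> d0" "3 * h \<le> d1" "3 * h \<le> d2"
    using d0 d1 d2 by (auto simp: h_def)
  have "ball x (3 * h) \<subseteq> V" using h(2) d0(2) by auto
  note sd = second_difference_eq_pd[OF this h(1) g gi]
  obtain p where p: "p \<in> ball x (3 * h)"
    "g (x + h *\<^sub>R axis i 1 + h *\<^sub>R axis j 1) - g (x + h *\<^sub>R axis i 1)
      - g (x + h *\<^sub>R axis j 1) + g x = h^2 * pd (pd g i) j p" using sd[of i j] by auto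
  obtain q where q: "q \<in> ball x (3 * h)"
    "g (x + h *\<^sub>R axis j 1 + h *\<^sub>R axis i 1) - g (x + h *\<^sub>R axis j 1)
      - g (x + h *\<^sub>R axis i 1) + g x = h^2 * pd (pd g j) i q" using sd[of j i] by auto
  have "x + h *\<^sub>R axis j 1 + h *\<^sub>R axis i 1 = x + h *\<^sub>R axis i 1 + h *\<^sub>R axis j 1"
    by (simp add: algebra_simps)
  then have "h^2 * pd (pd g i) j p = h^2 * pd (pd g j) i q"
    using p(2) q(2) by (simp only:)
  then have "pd (pd g i) j p = pd (pd g j) i q" using h by simp
  moreover have "\<bar>pd (pd g i) j p - pd (pd g i) j x\<bar> < e" "\<bar>pd (pd g j) i q - pd (pd g j) i x\<bar> < e"
    using p(1) q(1) h by (auto intro!: d1(2) d2(2) simp: dist_commute)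
  ultimately show False unfolding e_def by argo
qed

lemma smooth_on_dpart: "smooth_on F V \<Longrightarrow> y \<in> V \<Longrightarrow> dpart is F differentiable (at y)"
  by (simp add: smooth_on_def)

lemma smooth_onD:
  assumes "smooth_on F V" "y \<in> V"
  shows "F differentiable (at y)" "pd F i differentiable (at y)"
    "pd (pd F i) j differentiable (at y)"
  using smooth_on_dpart[OF assms, of "[]"] smooth_on_dpart[OF assms, of "[i]"]
    smooth_on_dpart[OF assms, of "[j, i]"] by simp_all

lemma smooth_on_pd: "smooth_on F V \<Longrightarrow> smooth_on (pd F i) V"
proof -
  \<comment> \<open>The head of the list is the outermost derivative, so differentiating by
    \<open>i\<close> first appends \<open>i\<close> at the end.\<close>
  have "dpart is (pd F i) = dpart (is @ [i]) F" for "is" by (induction "is") auto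
  then show "smooth_on F V \<Longrightarrow> smooth_on (pd F i) V" by (simp add: smooth_on_def)
qed

text \<open>The real case is applied to each component; second partials are continuous because
  \<open>smooth_on\<close> makes them differentiable.\<close>

theorem mixed_partials:
  fixes F :: "real^2 \<Rightarrow> real^'n"
  assumes V: "open V" "x \<in> V" and F: "smooth_on F V"
  shows "pd (pd F i) j x = pd (pd F j) i x"
proof -
  have 1: "pd (\<lambda>y. F y $ k) i y = pd F i y $ k" if "y \<in> V" for y k i
    by (rule pd_vec_nth) (use smooth_onD[OF F that] in auto)
  have 2: "pd (pd (\<lambda>y. F y $ k) i) j y = pd (pd F i) j y $ k" if "y \<in> V" for y k i j
    by (subst pd_cong[OF V(1) that 1], assumption) (rule pd_vec_nth, use smooth_onD[OF F that] in auto)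
  have "pd (pd (\<lambda>y. F y $ k) i) j x = pd (pd (\<lambda>y. F y $ k) j) i x" for k
  proof (rule mixed_partials_real[OF V])
    fix y assume y: "y \<in> V"
    show "(\<lambda>y. F y $ k) differentiable at y"
      by (rule vec_nth_differentiable) (use smooth_onD[OF F y] in auto)
    fix l show "pd (\<lambda>y. F y $ k) l differentiable at y"
      by (rule differentiable_cong_open[OF V(1) y 1], assumption)
        (rule vec_nth_differentiable, use smooth_onD[OF F y] in auto)
  next
    fix l m
    have "pd (pd (\<lambda>y. F y $ k) l) m differentiable at x"
      by (rule differentiable_cong_open[OF V 2], assumption)
        (rule vec_nth_differentiable, use smooth_onD[OF F V(2)] in auto)
    then show "isCont (pd (pd (\<lambda>y. F y $ k) l) m) x"
      by (rule differentiable_imp_continuous_within)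
  qed
  then show ?thesis by (simp add: vec_eq_iff 2[OF V(2)])
qed

section \<open>Moving frames in three-space\<close>

lemma det3_expand:
  "det3 a b c = a$1 * (b$2 * c$3 - b$3 * c$2) - a$2 * (b$1 * c$3 - b$3 * c$1) + a$3 * (b$1 * c$2 - b$2 * c$1)"
  by (simp add: det3_def det_3 algebra_simps)

lemma det3_linear:
  "det3 (a + a') b c = det3 a b c + det3 a' b c" "det3 a (b + b') c = det3 a b c + det3 a b' c"
  "det3 a b (c + c') = det3 a b c + det3 a b c'"
  "det3 (a - a') b c = det3 a b c - det3 a' b c" "det3 a (b - b') c = det3 a b c - det3 a b' c"
  "det3 a b (c - c') = det3 a b c - det3 a b c'"
  "det3 (r *\<^sub>R a) b c = r * det3 a b c" "det3 a (r *\<^sub>R b) c = r * det3 a b c"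
  "det3 a b (r *\<^sub>R c) = r * det3 a b c"
  "det3 a a c = 0" "det3 a b a = 0" "det3 a b b = 0"
  by (simp_all add: det3_expand algebra_simps)

lemma det3_perm:
  "det3 b a c = - det3 a b c" "det3 c b a = - det3 a b c" "det3 a c b = - det3 a b c"
  "det3 b c a = det3 a b c" "det3 c a b = det3 a b c"
  by (simp_all add: det3_expand algebra_simps)

lemma cramer3:
  assumes "det3 a b c \<noteq> 0"
  shows "v = (det3 v b c / det3 a b c) *\<^sub>R a + (det3 a v c / det3 a b c) *\<^sub>R b + (det3 a b v / det3 a b c) *\<^sub>R c"
proof -
  have "det3 a b c *\<^sub>R v = det3 v b c *\<^sub>R a + det3 a v c *\<^sub>R b + det3 a b v *\<^sub>R c"
    by (simp add: vec_eq_iff forall_3 det3_expand algebra_simps)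
  then have "v = (1 / det3 a b c) *\<^sub>R (det3 v b c *\<^sub>R a + det3 a v c *\<^sub>R b + det3 a b v *\<^sub>R c)"
    using assms by (metis divide_self_if scaleR_one scaleR_scaleR times_divide_eq_left mult_1)
  then show ?thesis by (simp add: scaleR_right_distrib)
qed

lemma frame_coefficients_unique:
  assumes "det3 a b c \<noteq> 0" "p *\<^sub>R a + q *\<^sub>R b + r *\<^sub>R c = p' *\<^sub>R a + q' *\<^sub>R b + r' *\<^sub>R c"
  shows "p = p'" "q = q'" "r = r'"
proof -
  let ?u = "p *\<^sub>R a + q *\<^sub>R b + r *\<^sub>R c" and ?v = "p' *\<^sub>R a + q' *\<^sub>R b + r' *\<^sub>R c"
  have "det3 ?u b c = det3 ?v b c" "det3 a ?u c = det3 a ?v c" "det3 a b ?u = det3 a b ?v"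
    using assms(2) by simp_all
  then show "p = p'" "q = q'" "r = r'" using assms(1) by (simp_all add: det3_linear)
qed

text \<open>In the Cramer expansion of \<open>v\<close>, the equation \<open>N v = 0\<close> forces
  the \<open>X\<close>-coefficient to be \<open>- a\<close> times the \<open>Y\<close>-coefficient.
  It is meant for \<open>N\<close> a conormal and \<open>v\<close> a derivative of the immersion or
  of its equiaffine field.\<close>

lemma hyperplane_decomposition:
  assumes N: "linear N" and NW: "N W = 0" and NX: "N X = 1" and NY: "N Y = a" and "N v = 0"
    and d: "det3 W X Y \<noteq> 0"
  shows "v = (det3 v X Y / det3 W X Y) *\<^sub>R W + (det3 W X v / det3 W X Y) *\<^sub>R (Y - a *\<^sub>R X)"
proof -
  define p q r where pqr: "p = det3 v X Y / det3 W X Y" "q = det3 W v Y / det3 W X Y"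
    "r = det3 W X v / det3 W X Y"
  have v: "v = p *\<^sub>R W + q *\<^sub>R X + r *\<^sub>R Y" unfolding pqr by (rule cramer3[OF d])
  have "N v = p * N W + q * N X + r * N Y"
    by (subst v) (simp only: linear_add[OF N] linear_scale[OF N] real_scaleR_def)
  then have "q = - (r * a)" using assms by simp
  then have "v = p *\<^sub>R W + r *\<^sub>R (Y - a *\<^sub>R X)" using v by (simp add: algebra_simps)
  then show ?thesis unfolding pqr .
qed

section \<open>Determinants and conormals along a surface\<close>

lemma det3_differentiable:
  assumes "P differentiable (at x)" "Q differentiable (at x)" "R differentiable (at x)"
  shows "(\<lambda>y. det3 (P y) (Q y) (R y)) differentiable (at x)"
  unfolding det3_expand
  by (intro differentiable_add differentiable_diff differentiable_mult vec_nth_differentiable assms)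

lemma pd_det3:
  assumes "P differentiable (at x)" "Q differentiable (at x)" "R differentiable (at x)"
  shows "pd (\<lambda>y. det3 (P y) (Q y) (R y)) i x
    = det3 (pd P i x) (Q x) (R x) + det3 (P x) (pd Q i x) (R x) + det3 (P x) (Q x) (pd R i x)"
  unfolding det3_expand
  by (simp add: pd_add pd_diff pd_mult pd_vec_nth assms vec_nth_differentiable
      differentiable_add differentiable_diff differentiable_mult algebra_simps)

lemma conormal_linear: "linear (conormal F X x)"
  by (rule linearI) (simp_all add: conormal_def det3_linear add_divide_distrib)

lemma conormal_tangent: "conormal F X x (pd F i x) = 0"
  using exhaust_2[of i] by (auto simp: conormal_def det3_linear)

lemma conormal_transversal: "vol F X x \<noteq> 0 \<Longrightarrow> conormal F X x (X x) = 1"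
  by (simp add: conormal_def vol_def)

text \<open>A covector of the plane that is parallel to two independent covectors vanishes.\<close>

lemma wedge_independence:
  fixes u1 u2 :: real
  assumes "be1 * ga2 - be2 * ga1 \<noteq> 0" "u1 * ga2 - u2 * ga1 = 0" "u1 * be2 - u2 * be1 = 0"
  shows "u1 = 0" "u2 = 0"
proof -
  have "u1 * (be1 * ga2 - be2 * ga1) = be1 * (u1 * ga2 - u2 * ga1) - ga1 * (u1 * be2 - u2 * be1)"
    "u2 * (be1 * ga2 - be2 * ga1) = be2 * (u1 * ga2 - u2 * ga1) - ga2 * (u1 * be2 - u2 * be1)"
    by (simp_all add: algebra_simps)
  then show "u1 = 0" "u2 = 0" using assms by auto
qed

text \<open>One-forms on the parameter domain are given by their two components;
  \<open>wedge\<close> and \<open>ext\<close> are the coefficients of the area form in the exterior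
  product and the exterior derivative.\<close>

definition wedge :: "(2 \<Rightarrow> real^2 \<Rightarrow> real) \<Rightarrow> (2 \<Rightarrow> real^2 \<Rightarrow> real) \<Rightarrow> real^2 \<Rightarrow> real" where
  "wedge u v x = u 1 x * v 2 x - u 2 x * v 1 x"

definition ext :: "(2 \<Rightarrow> real^2 \<Rightarrow> real) \<Rightarrow> real^2 \<Rightarrow> real" where
  "ext u x = pd (u 2) 1 x - pd (u 1) 2 x"

text \<open>The product rule, with the derivatives of the frame substituted. \<open>H\<close> is
  left general so that one computation serves the immersion and its transversal field, and after
  interchanging the surfaces also the other pair.\<close>

lemma frame_second_derivative:
  fixes H W X Y :: "real^2 \<Rightarrow> real^3" and p r :: "2 \<Rightarrow> real^2 \<Rightarrow> real"
  assumes V: "open V" "x \<in> V"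
    and H: "\<forall>y\<in>V. pd H j y = p j y *\<^sub>R W y + r j y *\<^sub>R (Y y - a *\<^sub>R X y)"
    and diff: "p j differentiable (at x)" "r j differentiable (at x)"
      "W differentiable (at x)" "X differentiable (at x)" "Y differentiable (at x)"
    and W: "pd W i x = (ga i x + a * be i x) *\<^sub>R X x - (be i x + b * ga i x) *\<^sub>R Y x"
    and X: "pd X i x = mu i x *\<^sub>R W x + la i x *\<^sub>R (Y x - a *\<^sub>R X x)"
    and Y: "pd Y i x = rh i x *\<^sub>R W x + si i x *\<^sub>R (X x - b *\<^sub>R Y x)"
  shows "pd (pd H j) i x = (pd (p j) i x + r j x * (rh i x - a * mu i x)) *\<^sub>R W x
    + (p j x * (ga i x + a * be i x) + r j x * (si i x + a^2 * la i x) - a * pd (r j) i x) *\<^sub>R X x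
    + (pd (r j) i x - p j x * (be i x + b * ga i x) - r j x * (b * si i x + a * la i x)) *\<^sub>R Y x"
proof -
  have dE: "(\<lambda>y. Y y - a *\<^sub>R X y) differentiable (at x)"
    by (intro differentiable_diff linear_differentiable[OF bounded_linear_scaleR_right] diff)
  have "pd (pd H j) i x = pd (\<lambda>y. p j y *\<^sub>R W y + r j y *\<^sub>R (Y y - a *\<^sub>R X y)) i x"
    by (rule pd_cong[OF V]) (use H in blast)
  also have "\<dots> = p j x *\<^sub>R pd W i x + pd (p j) i x *\<^sub>R W x
      + (r j x *\<^sub>R (pd Y i x - a *\<^sub>R pd X i x) + pd (r j) i x *\<^sub>R (Y x - a *\<^sub>R X x))"
    by (simp only: pd_add scaleR_differentiable diff dE pd_scaleR pd_diff
        linear_differentiable[OF bounded_linear_scaleR_right] pd_scaleR_const)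
  also have "\<dots> = (pd (p j) i x + r j x * (rh i x - a * mu i x)) *\<^sub>R W x
    + (p j x * (ga i x + a * be i x) + r j x * (si i x + a^2 * la i x) - a * pd (r j) i x) *\<^sub>R X x
    + (pd (r j) i x - p j x * (be i x + b * ga i x) - r j x * (b * si i x + a * la i x)) *\<^sub>R Y x"
    unfolding W X Y by (simp add: algebra_simps power2_eq_square)
  finally show ?thesis .
qed

text \<open>Symmetry of the second derivatives of \<open>H\<close>, compared coefficient by
  coefficient in the frame \<open>W\<close>, \<open>X\<close>, \<open>Y\<close>.\<close>

lemma frame_integrability:
  fixes H W X Y :: "real^2 \<Rightarrow> real^3" and p r :: "2 \<Rightarrow> real^2 \<Rightarrow> real"
  assumes V: "open V" "x \<in> V" and sm: "smooth_on H V"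
    and H: "\<And>i y. y \<in> V \<Longrightarrow> pd H i y = p i y *\<^sub>R W y + r i y *\<^sub>R (Y y - a *\<^sub>R X y)"
    and diff: "\<And>i. p i differentiable (at x)" "\<And>i. r i differentiable (at x)"
      "W differentiable (at x)" "X differentiable (at x)" "Y differentiable (at x)"
    and W: "\<And>i. pd W i x = (ga i x + a * be i x) *\<^sub>R X x - (be i x + b * ga i x) *\<^sub>R Y x"
    and X: "\<And>i. pd X i x = mu i x *\<^sub>R W x + la i x *\<^sub>R (Y x - a *\<^sub>R X x)"
    and Y: "\<And>i. pd Y i x = rh i x *\<^sub>R W x + si i x *\<^sub>R (X x - b *\<^sub>R Y x)"
    and nz: "det3 (W x) (X x) (Y x) \<noteq> 0" "1 - a * b \<noteq> 0"
  shows "wedge p ga x + wedge r si x = 0"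
    and "ext p x = wedge r rh x - a * wedge r mu x"
    and "ext r x = - wedge p be x - b * wedge p ga x - b * wedge r si x - a * wedge r la x"
proof -
  note sd = frame_second_derivative[where H = H and p = p and r = r and W = W and X = X and Y = Y
      and a = a and b = b and be = be and ga = ga and mu = mu and la = la and rh = rh and si = si, OF V _ diff W X Y]
  have H': "\<forall>y\<in>V. pd H i y = p i y *\<^sub>R W y + r i y *\<^sub>R (Y y - a *\<^sub>R X y)" for i
    using H by blast
  have eq: "pd (pd H 2) 1 x = pd (pd H 1) 2 x" by (rule mixed_partials[OF V sm])
  note co = frame_coefficients_unique[OF nz(1) eq[unfolded sd[OF H']]]
  show 1: "ext p x = wedge r rh x - a * wedge r mu x"
    using co(1) by (simp add: ext_def wedge_def algebra_simps)
  show 3: "ext r x = - wedge p be x - b * wedge p ga x - b * wedge r si x - a * wedge r la x"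
    using co(3) by (simp add: ext_def wedge_def algebra_simps)
  \<comment> \<open>Adding \<open>a\<close> times the \<open>Y\<close>-equation to the
    \<open>X\<close>-equation removes \<open>ext r\<close> and leaves the common factor
    \<open>1 - a * b\<close>.\<close>
  have "(1 - a * b) * (wedge p ga x + wedge r si x) = 0"
    using co(2) 3 unfolding ext_def wedge_def by algebra
  then show "wedge p ga x + wedge r si x = 0" using nz(2) by simp
qed

section \<open>Affine fundamental forms and the Gauss equation\<close>

text \<open>The conormal takes the values 0, 1, \<open>a\<close> on \<open>W\<close>,
  \<open>X\<close>, \<open>Y\<close>, so the second derivatives give the fundamental form as
  \<open>1 - a * b\<close> times the sum of the tensor products of \<open>ga\<close> with
  \<open>p\<close> and of \<open>si\<close> with \<open>r\<close>. As a matrix this is a product of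
  two 2 by 2 matrices, whence the factored determinant.\<close>

lemma frame_fundamental_form:
  fixes H W X Y :: "real^2 \<Rightarrow> real^3" and p r :: "2 \<Rightarrow> real^2 \<Rightarrow> real"
  assumes V: "open V" "x \<in> V"
    and H: "\<And>i y. y \<in> V \<Longrightarrow> pd H i y = p i y *\<^sub>R W y + r i y *\<^sub>R (Y y - a *\<^sub>R X y)"
    and diff: "\<And>i. p i differentiable (at x)" "\<And>i. r i differentiable (at x)"
      "W differentiable (at x)" "X differentiable (at x)" "Y differentiable (at x)"
    and W: "\<And>i. pd W i x = (ga i x + a * be i x) *\<^sub>R X x - (be i x + b * ga i x) *\<^sub>R Y x"
    and X: "\<And>i. pd X i x = mu i x *\<^sub>R W x + la i x *\<^sub>R (Y x - a *\<^sub>R X x)"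
    and Y: "\<And>i. pd Y i x = rh i x *\<^sub>R W x + si i x *\<^sub>R (X x - b *\<^sub>R Y x)"
    and nz: "det3 (W x) (X x) (Y x) \<noteq> 0" "wedge p r x \<noteq> 0"
  shows "vol H X x = - wedge p r x * det3 (W x) (X x) (Y x)"
    and "deth H X x = (1 - a * b)^2 * wedge p r x * wedge ga si x"
proof -
  let ?d = "det3 (W x) (X x) (Y x)"
  have det: "det3 (pd H 1 x) (pd H 2 x) w = wedge p r x * (det3 (W x) (Y x) w - a * det3 (W x) (X x) w)" for w
    unfolding H[OF V(2)] wedge_def
    by (simp add: det3_linear det3_perm(1)[of "Y x" "W x"] det3_perm(1)[of "X x" "W x"] det3_perm(1)[of "Y x" "X x"] algebra_simps)
  show vol: "vol H X x = - wedge p r x * ?d"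
    unfolding vol_def det by (simp add: det3_linear det3_perm(3)[of "W x" "Y x" "X x"])
  have con: "conormal H X x (c1 *\<^sub>R W x + c2 *\<^sub>R X x + c3 *\<^sub>R Y x) = c2 + a * c3" for c1 c2 c3
    unfolding conormal_def vol det using nz
    by (simp add: det3_linear det3_perm(3)[of "W x" "Y x" "X x"] field_simps)
  have H': "\<forall>y\<in>V. pd H i y = p i y *\<^sub>R W y + r i y *\<^sub>R (Y y - a *\<^sub>R X y)" for i
    using H by blast
  note sd = frame_second_derivative[where H = H and p = p and r = r and W = W and X = X and Y = Y
      and a = a and b = b and be = be and ga = ga and mu = mu and la = la and rh = rh and si = si, OF V H' diff W X Y]
  have afh: "afh H X i j x = (1 - a * b) * (p j x * ga i x + r j x * si i x)" for i j
    unfolding afh_def sd con by (simp add: algebra_simps power2_eq_square)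
  show "deth H X x = (1 - a * b)^2 * wedge p r x * wedge ga si x"
    unfolding deth_def wedge_def afh by algebra
qed

section \<open>The induced connection, the Gauss equation and the image of the curvature\<close>

lemma christ_differentiable:
  assumes "x \<in> V" "smooth_on F V" "smooth_on X V" "vol F X x \<noteq> 0"
  shows "christ F X k i j differentiable (at x)" "afh F X i j differentiable (at x)"
proof -
  note sm = smooth_onD[OF assms(2,1)] smooth_onD[OF assms(3,1)]
  have "(\<lambda>y. det3 (pd (pd F j) i y) (pd F 2 y) (X y) / vol F X y) differentiable (at x)"
    "(\<lambda>y. det3 (pd F 1 y) (pd (pd F j) i y) (X y) / vol F X y) differentiable (at x)"
    "(\<lambda>y. det3 (pd F 1 y) (pd F 2 y) (pd (pd F j) i y) / vol F X y) differentiable (at x)"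
    unfolding vol_def
    by (intro differentiable_divide det3_differentiable sm assms(4)[unfolded vol_def])+
  then show "christ F X k i j differentiable (at x)" "afh F X i j differentiable (at x)"
    unfolding christ_def afh_def conormal_def by (cases "k = 1"; simp)+
qed

text \<open>\<open>christ\<close> and \<open>afh\<close> are by definition Cramer coefficients in
  the frame formed by the two partials of \<open>F\<close> and \<open>X\<close>.\<close>

lemma gauss_formula:
  assumes "vol F X y \<noteq> 0"
  shows "pd (pd F j) i y = christ F X 1 i j y *\<^sub>R pd F 1 y + christ F X 2 i j y *\<^sub>R pd F 2 y
    + afh F X i j y *\<^sub>R X y"
  using cramer3[OF assms[unfolded vol_def], of "pd (pd F j) i y"]
  by (simp add: christ_def afh_def conormal_def vol_def)

text \<open>\<open>S\<close> is the matrix of the shape operator. Third derivatives of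
  \<open>F\<close> are computed from the Gauss formula; their symmetry in the two outer indices is
  read off in the tangential coefficients.\<close>

theorem gauss_equation:
  assumes V: "open V" "x \<in> V" and sm: "smooth_on F V" "smooth_on X V"
    and vol: "\<And>y. y \<in> V \<Longrightarrow> vol F X y \<noteq> 0"
    and S: "\<And>i. pd X i x = - (S 1 i *\<^sub>R pd F 1 x + S 2 i *\<^sub>R pd F 2 x)"
  shows "curv (christ F X) l k i j x = afh F X j k x * S l i - afh F X i k x * S l j"
proof -
  let ?\<Gamma> = "christ F X" and ?h = "afh F X"
  note D = smooth_onD[OF sm(1) V(2)] smooth_onD[OF sm(2) V(2)]
    christ_differentiable[OF V(2) sm vol[OF V(2)]]
  have third: "pd (pd (pd F k) j) i x
    = (pd (?\<Gamma> 1 j k) i x + (?\<Gamma> 1 j k x * ?\<Gamma> 1 i 1 x + ?\<Gamma> 2 j k x * ?\<Gamma> 1 i 2 x) - ?h j k x * S 1 i) *\<^sub>R pd F 1 x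
    + (pd (?\<Gamma> 2 j k) i x + (?\<Gamma> 1 j k x * ?\<Gamma> 2 i 1 x + ?\<Gamma> 2 j k x * ?\<Gamma> 2 i 2 x) - ?h j k x * S 2 i) *\<^sub>R pd F 2 x
    + (pd (?h j k) i x + ?\<Gamma> 1 j k x * ?h i 1 x + ?\<Gamma> 2 j k x * ?h i 2 x) *\<^sub>R X x" for i j k
  proof -
    have "pd (pd (pd F k) j) i x = pd (\<lambda>y. ?\<Gamma> 1 j k y *\<^sub>R pd F 1 y + ?\<Gamma> 2 j k y *\<^sub>R pd F 2 y
        + ?h j k y *\<^sub>R X y) i x"
      by (rule pd_cong[OF V]) (rule gauss_formula[OF vol])
    also have "\<dots> = (?\<Gamma> 1 j k x *\<^sub>R pd (pd F 1) i x + pd (?\<Gamma> 1 j k) i x *\<^sub>R pd F 1 x)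
       + (?\<Gamma> 2 j k x *\<^sub>R pd (pd F 2) i x + pd (?\<Gamma> 2 j k) i x *\<^sub>R pd F 2 x)
       + (?h j k x *\<^sub>R pd X i x + pd (?h j k) i x *\<^sub>R X x)"
      by (simp only: pd_add pd_scaleR D scaleR_differentiable differentiable_add)
    also have "\<dots> = (pd (?\<Gamma> 1 j k) i x + (?\<Gamma> 1 j k x * ?\<Gamma> 1 i 1 x + ?\<Gamma> 2 j k x * ?\<Gamma> 1 i 2 x) - ?h j k x * S 1 i) *\<^sub>R pd F 1 x
      + (pd (?\<Gamma> 2 j k) i x + (?\<Gamma> 1 j k x * ?\<Gamma> 2 i 1 x + ?\<Gamma> 2 j k x * ?\<Gamma> 2 i 2 x) - ?h j k x * S 2 i) *\<^sub>R pd F 2 x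
      + (pd (?h j k) i x + ?\<Gamma> 1 j k x * ?h i 1 x + ?\<Gamma> 2 j k x * ?h i 2 x) *\<^sub>R X x"
      unfolding gauss_formula[OF vol[OF V(2)]] S by (simp add: algebra_simps)
    finally show ?thesis .
  qed
  have eq: "pd (pd (pd F k) j) i x = pd (pd (pd F k) i) j x"
    by (rule mixed_partials[OF V smooth_on_pd[OF sm(1)]])
  note co = frame_coefficients_unique[OF vol[OF V(2), unfolded vol_def] eq[unfolded third]]
  show ?thesis
    using co(1,2) exhaust_2[of l] by (auto simp: curv_def sum_2)
qed

text \<open>The shape operator has its image in one line, so by the Gauss equation every curvature
  vector lies in that line. This is the obstruction that later excludes
  \<open>m = 0\<close>.\<close>

lemma dim_im_curv_le_1:
  fixes c e :: "2 \<Rightarrow> real"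
  assumes V: "open V" "x \<in> V" and sm: "smooth_on F V" "smooth_on X V"
    and vol: "\<And>y. y \<in> V \<Longrightarrow> vol F X y \<noteq> 0"
    and X: "\<And>i. pd X i x = c i *\<^sub>R (e 1 *\<^sub>R pd F 1 x + e 2 *\<^sub>R pd F 2 x)"
  shows "dim_im_curv (christ F X) x \<le> 1"
proof -
  let ?e = "\<chi> l. e l"
  have "curv (christ F X) l k i j x = (afh F X i k x * c j - afh F X j k x * c i) * e l" for l k i j
    by (subst gauss_equation[OF V sm vol, of "\<lambda>l i. - c i * e l"])
       (simp_all add: X algebra_simps)
  then have "(\<chi> l. curv (christ F X) l k i j x) = (afh F X i k x * c j - afh F X j k x * c i) *\<^sub>R ?e" for k i j
    by (simp add: vec_eq_iff)
  then have "{(\<chi> l. curv (christ F X) l k i j x) | i j k. True} \<subseteq> span {?e}"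
    by (auto simp: span_singleton)
  then have "dim_im_curv (christ F X) x \<le> card {?e}"
    unfolding dim_im_curv_def by (intro dim_le_card) auto
  then show ?thesis by simp
qed

section \<open>Constant bilinear forms, Levi-Civita connection and sectional curvature\<close>

lemma bform_bilinear: "bounded_bilinear (bform Q)"
  unfolding bform_def
  by (rule bounded_bilinear.comp[OF bounded_bilinear_inner bounded_linear_ident
        matrix_vector_mul_bounded_linear])

lemma bform_linear:
  "bform Q (u + u') v = bform Q u v + bform Q u' v" "bform Q u (v + v') = bform Q u v + bform Q u v'"
  "bform Q (u - u') v = bform Q u v - bform Q u' v" "bform Q u (v - v') = bform Q u v - bform Q u v'"
  "bform Q (c *\<^sub>R u) v = c * bform Q u v" "bform Q u (c *\<^sub>R v) = c * bform Q u v"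
  "bform Q (- u) v = - bform Q u v" "bform Q u (- v) = - bform Q u v"
  using bform_bilinear[of Q]
  by (simp_all add: bounded_bilinear.add_left bounded_bilinear.add_right bounded_bilinear.diff_left
      bounded_bilinear.diff_right bounded_bilinear.scaleR_left bounded_bilinear.scaleR_right
      bounded_bilinear.minus_left bounded_bilinear.minus_right)

lemma bform_sym: "transpose Q = Q \<Longrightarrow> bform Q u v = bform Q v u"
  by (metis bform_def dot_lmul_matrix inner_commute transpose_matrix_vector)

lemma matrix_inv_inverse:
  fixes A :: "'a::semiring_1^'n^'m"
  assumes "invertible A"
  shows "A ** matrix_inv A = mat 1" "matrix_inv A ** A = mat 1"
  using someI_ex[OF assms[unfolded invertible_def]] unfolding matrix_inv_def by blast+

text \<open>Since \<open>Q\<close> is constant, the Koszul expression equals twice the product of a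
  second derivative of \<open>F\<close> with a tangent vector. Orthogonality of \<open>X\<close>
  keeps only the \<open>christ\<close> terms, and the inverse metric cancels the metric.\<close>

lemma lc_christ_eq_christ:
  assumes V: "open V" "y \<in> V" and sm: "smooth_on F V" and vol: "vol F X y \<noteq> 0"
    and Q: "transpose Q = Q" and orth: "\<And>i. bform Q (X y) (pd F i y) = 0"
    and nd: "indmet_det Q F y \<noteq> 0"
  shows "lc_christ Q F k i j y = christ F X k i j y"
proof -
  note D = smooth_onD[OF sm V(2)]
  let ?g = "\<chi> a b. indmet Q F a b y"
  have pdg: "pd (indmet Q F a b) c y = bform Q (pd F a y) (pd (pd F b) c y) + bform Q (pd (pd F a) c y) (pd F b y)" for a b c
    unfolding indmet_def[abs_def] by (rule pd_bilinear[OF bform_bilinear D(2) D(2)])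
  have "pd (indmet Q F j l) i y + pd (indmet Q F i l) j y - pd (indmet Q F i j) l y
      = 2 * bform Q (pd (pd F j) i y) (pd F l y)" for l
    unfolding pdg using mixed_partials[OF V sm, of i j] mixed_partials[OF V sm, of l i]
      mixed_partials[OF V sm, of l j] bform_sym[OF Q]
    by (smt (verit))
  moreover have "bform Q (pd (pd F j) i y) (pd F l y) = (\<Sum>m\<in>UNIV. ?g $ l $ m * christ F X m i j y)" for l
    unfolding gauss_formula[OF vol, of j i] using orth
    by (simp add: sum_2 indmet_def bform_linear bform_sym[OF Q, of "pd F l y"])
  ultimately have "lc_christ Q F k i j y
      = (\<Sum>l\<in>UNIV. matrix_inv ?g $ k $ l * (\<Sum>m\<in>UNIV. ?g $ l $ m * christ F X m i j y))"
    unfolding lc_christ_def by (simp add: sum_distrib_left[symmetric] mult.assoc[symmetric] sum_divide_distrib)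
  also have "\<dots> = (matrix_inv ?g *v (?g *v (\<chi> m. christ F X m i j y))) $ k"
    by (simp add: matrix_vector_mult_def)
  also have "\<dots> = christ F X k i j y"
  proof -
    have "det ?g \<noteq> 0" using nd by (simp add: det_2 indmet_det_def)
    then have "matrix_inv ?g ** ?g = mat 1"
      by (simp add: invertible_det_nz matrix_inv_inverse)
    then show ?thesis by (simp add: matrix_vector_mul_assoc)
  qed
  finally show ?thesis .
qed

text \<open>Differentiating the orthogonality of \<open>X\<close> and the surface expresses the
  shape operator through \<open>afh\<close> and \<open>bform Q (X x) (X x)\<close>. Inserting this
  in the Gauss equation turns the curvature into a multiple of \<open>deth\<close>.\<close>

theorem sect_curv_eq:
  assumes V: "open V" "x \<in> V" and sm: "smooth_on F V" "smooth_on X V"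
    and vol: "\<And>y. y \<in> V \<Longrightarrow> vol F X y \<noteq> 0"
    and tau: "\<And>i. tau F X i x = 0"
    and Q: "transpose Q = Q" and orth: "\<And>y i. y \<in> V \<Longrightarrow> bform Q (X y) (pd F i y) = 0"
    and nd: "\<And>y. y \<in> V \<Longrightarrow> indmet_det Q F y \<noteq> 0"
  shows "sect_curv Q F x = bform Q (X x) (X x) * deth F X x / indmet_det Q F x"
proof -
  note D = smooth_onD[OF sm(1) V(2)] smooth_onD[OF sm(2) V(2)]
  \<comment> \<open>Tangential Cramer coefficients of the derivative of \<open>X\<close>, up to
    sign; the transversal one vanishes by \<open>tau\<close>.\<close>
  define S where "S l i = - (if l = 1 then det3 (pd X i x) (pd F 2 x) (X x) else det3 (pd F 1 x) (pd X i x) (X x)) / vol F X x"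
    for l i :: 2
  have S: "pd X i x = - (S 1 i *\<^sub>R pd F 1 x + S 2 i *\<^sub>R pd F 2 x)" for i
  proof -
    have "det3 (pd F 1 x) (pd F 2 x) (pd X i x) = 0"
      using tau[of i] vol[OF V(2)] by (simp add: tau_def conormal_def)
    then show ?thesis using cramer3[OF vol[OF V(2), unfolded vol_def], of "pd X i x"]
      by (simp add: S_def vol_def add.commute)
  qed
  have weingarten: "bform Q (pd X i x) (pd F j x) = - afh F X i j x * bform Q (X x) (X x)" for i j
  proof -
    have "pd (\<lambda>y. bform Q (X y) (pd F j y)) i x = pd (\<lambda>y. 0) i x"
      by (rule pd_cong[OF V]) (use orth in blast)
    then have "bform Q (X x) (pd (pd F j) i x) + bform Q (pd X i x) (pd F j x) = 0"
      by (simp add: pd_bilinear[OF bform_bilinear] D pd_const)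
    then show ?thesis using orth[OF V(2)] by (simp add: gauss_formula[OF vol[OF V(2)], of j i] bform_linear)
  qed
  have "lc_christ Q F k i j y = christ F X k i j y" if "y \<in> V" for k i j y
    by (rule lc_christ_eq_christ[OF V(1) that sm(1) vol[OF that] Q orth[OF that] nd[OF that]])
  then have curv: "curv (lc_christ Q F) l k i j x = curv (christ F X) l k i j x" for l k i j
    unfolding curv_def using V by (auto simp: pd_cong[OF V, of "lc_christ Q F _ _ _" "christ F X _ _ _"])
  have "(\<Sum>l\<in>UNIV. curv (lc_christ Q F) l 2 1 2 x * indmet Q F l 1 x)
     = - afh F X 2 2 x * bform Q (pd X 1 x) (pd F 1 x) + afh F X 1 2 x * bform Q (pd X 2 x) (pd F 1 x)"
    by (simp add: curv gauss_equation[OF V sm vol S] sum_2 S indmet_def bform_linear algebra_simps)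
  also have "\<dots> = bform Q (X x) (X x) * deth F X x"
    unfolding weingarten deth_def by (simp add: algebra_simps)
  finally show ?thesis by (simp add: sect_curv_def)
qed

section \<open>The structure equations of a pair of surfaces\<close>

text \<open>The situation in one chart: \<open>F\<close>, \<open>G\<close>, \<open>X\<close>,
  \<open>Y\<close> are the local expressions of \<open>f\<close>, \<open>fh\<close>,
  \<open>\<xi>\<close>, \<open>\<xi>h\<close>, and \<open>al\<close> to \<open>si\<close> are the
  one-forms \<alpha>, \<beta>, \<gamma>, \<mu>, \<lambda>, \<rho>, \<sigma>. The sixth assumption is
  encoded by the common \<open>al\<close> in \<open>pdF\<close> and \<open>pdG\<close>, the rank
  condition by \<open>kap\<close> and \<open>be_ga\<close>, transversality by \<open>al_be\<close>
  and \<open>al_ga\<close>.\<close>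

locale backlund_frame =
  fixes V :: "(real^2) set" and F G X Y :: "real^2 \<Rightarrow> real^3" and a b :: real
    and al be ga mu la rh si :: "2 \<Rightarrow> real^2 \<Rightarrow> real"
  assumes V: "open V"
    and sm: "smooth_on F V" "smooth_on G V" "smooth_on X V" "smooth_on Y V"
    and diff_forms: "\<And>i y. y \<in> V \<Longrightarrow> al i differentiable (at y)" "\<And>i y. y \<in> V \<Longrightarrow> be i differentiable (at y)"
      "\<And>i y. y \<in> V \<Longrightarrow> ga i differentiable (at y)" "\<And>i y. y \<in> V \<Longrightarrow> mu i differentiable (at y)"
      "\<And>i y. y \<in> V \<Longrightarrow> la i differentiable (at y)" "\<And>i y. y \<in> V \<Longrightarrow> rh i differentiable (at y)"
      "\<And>i y. y \<in> V \<Longrightarrow> si i differentiable (at y)"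
    and pdF: "\<And>i y. y \<in> V \<Longrightarrow> pd F i y = al i y *\<^sub>R (G y - F y) + be i y *\<^sub>R (Y y - a *\<^sub>R X y)"
    and pdG: "\<And>i y. y \<in> V \<Longrightarrow> pd G i y = al i y *\<^sub>R (G y - F y) + ga i y *\<^sub>R (X y - b *\<^sub>R Y y)"
    and pdX: "\<And>i y. y \<in> V \<Longrightarrow> pd X i y = mu i y *\<^sub>R (G y - F y) + la i y *\<^sub>R (Y y - a *\<^sub>R X y)"
    and pdY: "\<And>i y. y \<in> V \<Longrightarrow> pd Y i y = rh i y *\<^sub>R (G y - F y) + si i y *\<^sub>R (X y - b *\<^sub>R Y y)"
    and frame: "\<And>y. y \<in> V \<Longrightarrow> det3 (G y - F y) (X y) (Y y) \<noteq> 0"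
    and kap: "1 - a * b \<noteq> 0"
    and be_ga: "\<And>y. y \<in> V \<Longrightarrow> wedge be ga y \<noteq> 0"
    and al_be: "\<And>y. y \<in> V \<Longrightarrow> wedge al be y \<noteq> 0"
    and al_ga: "\<And>y. y \<in> V \<Longrightarrow> wedge al ga y \<noteq> 0"
    and nondeg: "\<And>y. y \<in> V \<Longrightarrow> deth F X y \<noteq> 0"
    and det_h: "\<And>y. y \<in> V \<Longrightarrow> det3 (G y - F y) (X y) (Y y) ^ 4 * det_theta_h F X y * det_theta_h G Y y
        = (1 - a * b) ^ 4"
    and dependent: "\<And>y. y \<in> V \<Longrightarrow> pd (\<lambda>y. det3 (G y - F y) (X y) (Y y)) 1 y * pd (det_theta_h F X) 2 y
        = pd (\<lambda>y. det3 (G y - F y) (X y) (Y y)) 2 y * pd (det_theta_h F X) 1 y"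
    and curv: "\<And>y. y \<in> V \<Longrightarrow> dim_im_curv (christ F X) y = 2"
    and ab: "a \<noteq> 0 \<or> b \<noteq> 0"
begin

abbreviation "W y \<equiv> G y - F y"
abbreviation "dl y \<equiv> det3 (W y) (X y) (Y y)"

lemma diff_W: "y \<in> V \<Longrightarrow> W differentiable (at y)"
  by (intro differentiable_diff smooth_onD[OF sm(1)] smooth_onD[OF sm(2)])

lemma diffs: "y \<in> V \<Longrightarrow> X differentiable (at y)" "y \<in> V \<Longrightarrow> Y differentiable (at y)"
  using smooth_onD[OF sm(3)] smooth_onD[OF sm(4)] by auto

lemma pdW: "y \<in> V \<Longrightarrow> pd W i y = (ga i y + a * be i y) *\<^sub>R X y - (be i y + b * ga i y) *\<^sub>R Y y"
  by (subst pd_diff) (auto intro: smooth_onD[OF sm(1)] smooth_onD[OF sm(2)] simp: pdF pdG algebra_simps)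

lemma pdW': "y \<in> V \<Longrightarrow> pd W i y = (- be i y + b * (- ga i y)) *\<^sub>R Y y - (- ga i y + a * (- be i y)) *\<^sub>R X y"
  by (simp add: pdW algebra_simps)

lemma frame': "y \<in> V \<Longrightarrow> det3 (W y) (Y y) (X y) \<noteq> 0"
  using frame by (simp add: det3_perm(3)[of "W y" "Y y" "X y"])

lemma kap': "1 - b * a \<noteq> 0" using kap by (simp add: mult.commute)

lemmas integrability = frame_integrability[where W = W and X = X and Y = Y and a = a and b = b
    and be = be and ga = ga and mu = mu and la = la and rh = rh and si = si,
    OF V _ _ _ _ _ diff_W diffs pdW pdX pdY frame kap]

text \<open>Interchanging the two surfaces amounts to \<open>(X, a, mu, la) \<leftrightarrow> (Y, b, rh, si)\<close> with \<open>W\<close> kept, which replaces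
  \<open>(be, ga)\<close> by \<open>(- ga, - be)\<close>.\<close>

lemmas integrability' = frame_integrability[where W = W and X = Y and Y = X and a = b and b = a
    and be = "\<lambda>i y. - ga i y" and ga = "\<lambda>i y. - be i y" and mu = rh and la = si and rh = mu and si = la,
    OF V _ _ _ _ _ diff_W diffs(2,1) pdW' pdY pdX frame' kap']

lemmas fundamental = frame_fundamental_form[where H = F and p = al and r = be and W = W and X = X and Y = Y and a = a and b = b
    and be = be and ga = ga and mu = mu and la = la and rh = rh and si = si,
    OF V _ pdF diff_forms(1,2) diff_W diffs pdW pdX pdY frame al_be]

lemmas fundamental' = frame_fundamental_form[where H = G and p = al and r = ga and W = W and X = Y and Y = X and a = b and b = a
    and be = "\<lambda>i y. - ga i y" and ga = "\<lambda>i y. - be i y" and mu = rh and la = si and rh = mu and si = la,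
    OF V _ pdG diff_forms(1,3) diff_W diffs(2,1) pdW' pdY pdX frame' al_ga]

text \<open>Three integrability conditions for each of \<open>F\<close>, \<open>X\<close>,
  \<open>G\<close>, \<open>Y\<close>, the last two after the interchange. As \<open>al\<close>
  belongs to both surfaces, \<open>ext al\<close> is obtained twice; the comparison of the two
  values is used later.\<close>

lemma structure_equations:
  assumes x: "x \<in> V"
  shows "wedge al ga x + wedge be si x = 0" "wedge mu ga x + wedge la si x = 0"
    "wedge al be x = wedge ga la x" "wedge rh be x = wedge si la x"
    "ext al x = wedge be rh x - a * wedge be mu x" "ext al x = wedge ga mu x - b * wedge ga rh x"
    "ext be x = - wedge al be x - b * wedge al ga x - b * wedge be si x - a * wedge be la x"
    "ext ga x = wedge al ga x + a * wedge al be x - a * wedge ga la x - b * wedge ga si x"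
    "ext mu x = wedge la rh x - a * wedge la mu x" "ext rh x = wedge si mu x - b * wedge si rh x"
    "ext la x = - wedge mu be x - b * wedge mu ga x - b * wedge la si x - a * wedge la la x"
    "ext si x = wedge rh ga x + a * wedge rh be x - a * wedge si la x - b * wedge si si x"
proof -
  have neg: "wedge p (\<lambda>i y. - q i y) x = - wedge p q x" for p q by (simp add: wedge_def)
  note i = integrability[OF x _ _ _ _ x x x x x x x] and i' = integrability'[OF x _ _ _ _ x x x x x x x]
  note F = i[OF sm(1) pdF diff_forms(1)[OF x] diff_forms(2)[OF x]]
    and X = i[OF sm(3) pdX diff_forms(4)[OF x] diff_forms(5)[OF x]]
    and G = i'[OF sm(2) pdG diff_forms(1)[OF x] diff_forms(3)[OF x], unfolded neg]
    and Y = i'[OF sm(4) pdY diff_forms(6)[OF x] diff_forms(7)[OF x], unfolded neg]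
  show "wedge al ga x + wedge be si x = 0" "ext al x = wedge be rh x - a * wedge be mu x"
    "ext be x = - wedge al be x - b * wedge al ga x - b * wedge be si x - a * wedge be la x"
    using F by simp_all
  show "wedge mu ga x + wedge la si x = 0" "ext mu x = wedge la rh x - a * wedge la mu x"
    "ext la x = - wedge mu be x - b * wedge mu ga x - b * wedge la si x - a * wedge la la x"
    using X by simp_all
  show "wedge al be x = wedge ga la x" "ext al x = wedge ga mu x - b * wedge ga rh x"
    "ext ga x = wedge al ga x + a * wedge al be x - a * wedge ga la x - b * wedge ga si x"
    using G by simp_all
  show "wedge rh be x = wedge si la x" "ext rh x = wedge si mu x - b * wedge si rh x"
    "ext si x = wedge rh ga x + a * wedge rh be x - a * wedge si la x - b * wedge si si x"
    using Y by simp_all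
qed

text \<open>\<open>t\<close> and \<open>m\<close> are the factors in \<open>si = t la\<close> and
  \<open>mu = m ga\<close>, proved below. The quotients of wedge products make them
  differentiable.\<close>

definition "t y = wedge ga si y / wedge al be y"
definition "m y = wedge be mu y / wedge be ga y"

text \<open>Both fundamental forms come from \<open>frame_fundamental_form\<close>. In the fifth
  assumption the powers of \<open>dl\<close> and of \<open>1 - a * b\<close> cancel, which leaves
  the last relation between wedge products.\<close>

lemma deths:
  assumes x: "x \<in> V"
  shows "vol F X x = - wedge al be x * dl x" "vol G Y x = wedge al ga x * dl x"
    "deth F X x = (1 - a * b)^2 * wedge al be x * wedge ga si x"
    "deth G Y x = - ((1 - a * b)^2) * wedge al ga x * wedge be la x"
    "det_theta_h F X x = (1 - a * b)^2 * t x / dl x ^ 2"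
    "wedge ga si x \<noteq> 0" "wedge ga si x * wedge be la x = - wedge al be x * wedge al ga x"
proof -
  note f = fundamental[OF x _ x x x x x x x x x x] and f' = fundamental'[OF x _ x x x x x x x x x x]
  show v: "vol F X x = - wedge al be x * dl x" using f(1) by simp
  show v': "vol G Y x = wedge al ga x * dl x" using f'(1) by (simp add: det3_perm(3)[of "W x" "Y x" "X x"])
  show d: "deth F X x = (1 - a * b)^2 * wedge al be x * wedge ga si x" using f(2) by simp
  show d': "deth G Y x = - ((1 - a * b)^2) * wedge al ga x * wedge be la x"
    using f'(2) by (simp add: wedge_def mult.commute[of b a] algebra_simps)
  have simplify: "k * w * s / (- w * d)^2 = k * (s / w) / d^2" if "w \<noteq> 0" "d \<noteq> 0" for k w s d :: real
    using that by (simp add: field_simps power2_eq_square)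
  show h: "det_theta_h F X x = (1 - a * b)^2 * t x / dl x ^ 2"
    unfolding det_theta_h_def v d t_def by (rule simplify[OF al_be[OF x] frame[OF x]])
  have h': "det_theta_h G Y x = - ((1 - a * b)^2) * (wedge be la x / wedge al ga x) / dl x ^ 2"
    unfolding det_theta_h_def v' d' using al_ga[OF x] frame[OF x] by (simp add: field_simps power2_eq_square)
  have cancel: "d ^ 4 * (k^2 * u / d^2) * (- (k^2) * v / d^2) = k^4 * (- (u * v))" if "d \<noteq> 0" for d k u v :: real
    using that by (simp add: field_simps power2_eq_square power4_eq_xxxx)
  show "wedge ga si x \<noteq> 0" using nondeg[OF x] d by auto
  have "dl x ^ 4 * det_theta_h F X x * det_theta_h G Y x
      = (1 - a * b)^4 * (- (t x * (wedge be la x / wedge al ga x)))"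
    unfolding h h' by (rule cancel[OF frame[OF x]])
  then have "(1 - a * b)^4 * (- (t x * (wedge be la x / wedge al ga x))) = (1 - a * b)^4 * 1"
    unfolding det_h[OF x] by simp
  moreover have "(1 - a * b)^4 \<noteq> 0" using kap by simp
  ultimately have "- (t x * (wedge be la x / wedge al ga x)) = 1"
    using mult_left_cancel by blast
  then show "wedge ga si x * wedge be la x = - wedge al be x * wedge al ga x"
    unfolding t_def using al_be[OF x] al_ga[OF x] by (simp add: field_simps)
qed

section \<open>Proportionality of the one-forms\<close>

lemma wedge_zeroD:
  assumes x: "x \<in> V" and "wedge u ga x = 0" "wedge u be x = 0"
  shows "u i x = 0"
proof -
  have "u 1 x = 0" "u 2 x = 0"
    using wedge_independence[OF be_ga[OF x, unfolded wedge_def] assms(2,3)[unfolded wedge_def]] by auto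
  then show ?thesis using exhaust_2[of i] by metis
qed

text \<open>The difference \<open>si - t la\<close> has zero wedge product with \<open>ga\<close> by
  the choice of \<open>t\<close> and \<open>wedge al be x = wedge ga la x\<close>, and with
  \<open>be\<close> by the fifth assumption in the form \<open>deths(7)\<close>.\<close>

lemma si_eq:
  assumes x: "x \<in> V"
  shows "si i x = t x * la i x"
proof -
  let ?u = "\<lambda>i y. si i y - t y * la i y"
  have lin: "wedge ?u v x = - wedge v si x + t x * wedge v la x" for v
    by (simp add: wedge_def algebra_simps)
  note S = structure_equations[OF x] deths(7)[OF x]
  have t: "t x * wedge al be x = wedge ga si x" using al_be[OF x] by (simp add: t_def)
  have "wedge ?u ga x = 0" unfolding lin using S(3) t by simp
  moreover have "wedge al be x * wedge ?u be x = 0"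
    unfolding lin using S(1) t deths(7)[OF x] by algebra
  then have "wedge ?u be x = 0" using al_be[OF x] by simp
  ultimately have "?u i x = 0" by (rule wedge_zeroD[OF x])
  then show ?thesis by simp
qed

text \<open>As \<open>si\<close> and \<open>la\<close> are parallel, the second structure equation
  reduces to \<open>wedge mu ga x = 0\<close>; pairing with \<open>be\<close> identifies the
  factor.\<close>

lemma mu_eq:
  assumes x: "x \<in> V"
  shows "mu i x = m x * ga i x"
proof -
  let ?u = "\<lambda>i y. mu i y - m y * ga i y"
  have "wedge la si x = 0" by (simp add: wedge_def si_eq[OF x])
  then have "wedge ?u ga x = 0" using structure_equations(2)[OF x] by (simp add: wedge_def algebra_simps)
  moreover have "m x * wedge be ga x = wedge be mu x" using be_ga[OF x] by (simp add: m_def)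
  then have "wedge ?u be x = 0" by (simp add: wedge_def algebra_simps)
  ultimately have "?u i x = 0" by (rule wedge_zeroD[OF x])
  then show ?thesis by simp
qed

text \<open>The analogue for the other surface: the fourth structure equation reduces to
  \<open>wedge rh be x = 0\<close>.\<close>

lemma rh_eq:
  assumes x: "x \<in> V"
  shows "rh i x = (wedge rh ga x / wedge be ga x) * be i x"
proof -
  define n where "n = wedge rh ga x / wedge be ga x"
  let ?u = "\<lambda>i y. rh i y - n * be i y"
  have "wedge si la x = 0" by (simp add: wedge_def si_eq[OF x])
  then have "wedge ?u be x = 0" using structure_equations(4)[OF x] by (simp add: wedge_def algebra_simps)
  moreover have "n * wedge be ga x = wedge rh ga x" using be_ga[OF x] by (simp add: n_def)
  then have "wedge ?u ga x = 0" by (simp add: wedge_def algebra_simps)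
  ultimately have "?u i x = 0" by (metis (no_types, lifting) wedge_zeroD[OF x, of ?u])
  then show ?thesis by (simp add: n_def)
qed

lemma diff_wedge:
  assumes "\<And>i. u i differentiable (at x)" "\<And>i. v i differentiable (at x)"
  shows "wedge u v differentiable (at x)"
  unfolding wedge_def[abs_def] by (intro differentiable_diff differentiable_mult assms)

lemma diff_t: "x \<in> V \<Longrightarrow> t differentiable (at x)"
  unfolding t_def[abs_def] by (intro differentiable_divide diff_wedge diff_forms al_be)

lemma diff_m: "x \<in> V \<Longrightarrow> m differentiable (at x)"
  unfolding m_def[abs_def] by (intro differentiable_divide diff_wedge diff_forms be_ga)

lemma diff_dl: "x \<in> V \<Longrightarrow> dl differentiable (at x)"
  by (intro det3_differentiable diff_W diffs)

lemma ext_product: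
  assumes x: "x \<in> V" and u: "\<And>i y. y \<in> V \<Longrightarrow> u i y = c y * v i y"
    and "c differentiable (at x)" "\<And>i. v i differentiable (at x)"
  shows "ext u x = wedge (pd c) v x + c x * ext v x"
proof -
  have "pd (u j) i x = c x * pd (v j) i x + pd c i x * v j x" for i j
    by (subst pd_cong[OF V x u], assumption) (rule pd_mult, use assms in auto)
  then show ?thesis by (simp add: ext_def wedge_def algebra_simps)
qed

text \<open>The logarithmic derivative of the frame determinant is the trace of the connection
  matrix. \<open>W\<close> contributes nothing, \<open>X\<close> and \<open>Y\<close> contribute
  \<open>- a la\<close> and \<open>- b si\<close>.\<close>

lemma pd_dl:
  assumes x: "x \<in> V"
  shows "pd dl i x = - (a + b * t x) * la i x * dl x"
proof -
  have "pd dl i x = - (a * la i x + b * si i x) * dl x"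
  proof -
    have "det3 (pd W i x) (X x) (Y x) = 0" by (simp add: pdW[OF x] det3_linear)
    moreover have "det3 (W x) (pd X i x) (Y x) = - a * la i x * dl x"
      \<comment> \<open>The fourth rule of \<open>det3_linear\<close> would split the difference
        \<open>G x - F x\<close> in the first slot, so it is left out.\<close>
      unfolding pdX[OF x] by (simp only: det3_linear(1-3,5-)) simp
    moreover have "det3 (W x) (X x) (pd Y i x) = - b * si i x * dl x"
      unfolding pdY[OF x] by (simp only: det3_linear(1-3,5-)) simp
    ultimately show ?thesis
      unfolding pd_det3[OF diff_W[OF x] diffs[OF x]] by (simp add: algebra_simps)
  qed
  then show ?thesis by (simp add: si_eq[OF x] algebra_simps)
qed

text \<open>With \<open>m x = 0\<close> the form \<open>mu\<close> vanishes at \<open>x\<close>, the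
  derivative of \<open>X\<close> takes values in the line of \<open>Y x - a *\<^sub>R X x\<close>,
  and the image of the curvature is at most a line.\<close>

lemma m_nonzero:
  assumes x: "x \<in> V"
  shows "m x \<noteq> 0"
proof
  assume m: "m x = 0"
  \<comment> \<open>The tangent vector that \<open>al\<close> annihilates and on which
    \<open>be\<close> equals 1; \<open>F\<close> maps it to
    \<open>Y x - a *\<^sub>R X x\<close>.\<close>
  define e1 e2 where e: "e1 = - al 2 x / wedge al be x" "e2 = al 1 x / wedge al be x"
  have "e1 *\<^sub>R pd F 1 x + e2 *\<^sub>R pd F 2 x
      = (e1 * al 1 x + e2 * al 2 x) *\<^sub>R W x + (e1 * be 1 x + e2 * be 2 x) *\<^sub>R (Y x - a *\<^sub>R X x)"
    unfolding pdF[OF x] by (simp add: algebra_simps)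
  also have "e1 * al 1 x + e2 * al 2 x = 0" unfolding e by simp
  also have "e1 * be 1 x + e2 * be 2 x = (al 1 x * be 2 x - al 2 x * be 1 x) / wedge al be x"
    unfolding e by (simp add: diff_divide_distrib)
  also have "\<dots> = 1" using al_be[OF x] by (simp add: wedge_def)
  finally have "Y x - a *\<^sub>R X x = e1 *\<^sub>R pd F 1 x + e2 *\<^sub>R pd F 2 x" by simp
  then have "pd X i x = la i x *\<^sub>R ((if (1::2) = 1 then e1 else e2) *\<^sub>R pd F 1 x + (if (2::2) = 1 then e1 else e2) *\<^sub>R pd F 2 x)" for i
    unfolding pdX[OF x] mu_eq[OF x] m by simp
  moreover have "vol F X y \<noteq> 0" if "y \<in> V" for y
    using deths(1)[OF that] al_be[OF that] frame[OF that] by simp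
  ultimately have "dim_im_curv (christ F X) x \<le> 1"
    by (intro dim_im_curv_le_1[OF V x sm(1,3), of "\<lambda>i. la i x" "\<lambda>i. if i = 1 then e1 else e2"]) auto
  then show False using curv[OF x] by simp
qed

text \<open>If the sum were nonzero, \<open>pd_dl\<close> would make \<open>la\<close> proportional
  to the differential of \<open>dl\<close>. The seventh assumption then gives
  \<open>wedge (pd t) la x = 0\<close>, hence \<open>n = t x * m x\<close>, while the two values of
  \<open>ext al\<close> give \<open>a * m x + b * n = 0\<close>. Together they contradict
  \<open>m x \<noteq> 0\<close>.\<close>

lemma t_const:
  assumes x: "x \<in> V"
  shows "a + b * t x = 0"
proof (rule ccontr)
  assume nz: "a + b * t x \<noteq> 0"
  define n where "n = wedge rh ga x / wedge be ga x"
  note rh = rh_eq[OF x, folded n_def]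
  let ?w = "wedge be ga x"
  have wed: "wedge rh ga x = n * ?w" "wedge rh be x = 0" "wedge si la x = 0" "wedge si si x = 0"
    "wedge mu be x = - m x * ?w" "wedge mu ga x = 0" "wedge la si x = 0" "wedge la la x = 0"
    "wedge be rh x = 0" "wedge be mu x = m x * ?w" "wedge ga mu x = 0" "wedge ga rh x = - n * ?w"
    by (simp_all add: wedge_def rh mu_eq[OF x] si_eq[OF x] algebra_simps)
  note S = structure_equations[OF x, unfolded wed]
  have "ext si x = wedge (pd t) la x + t x * ext la x"
    by (rule ext_product[OF x si_eq diff_t[OF x] diff_forms(5)[OF x]])
  \<comment> \<open>The exterior derivative of \<open>si\<close>, once from its structure equation
    and once from \<open>si = t la\<close>.\<close>
  then have 1: "n * ?w = wedge (pd t) la x + t x * (m x * ?w)" using S(11,12) by simp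
  have "(a * m x + b * n) * ?w = 0" using S(5,6) by (simp add: algebra_simps)
  then have 2: "a * m x + b * n = 0" using be_ga[OF x] by simp
  have quot: "(k^2 * t' * (d * d) - k^2 * u * (d * d' + d' * d)) / (d * d)^2
      = k^2 * (t' * d^2 - u * (2 * d * d')) / d^4" for k t' d u d' :: real
    by (simp add: power2_eq_square power4_eq_xxxx algebra_simps)
  \<comment> \<open>Differentiating the denominator of \<open>det_theta_h\<close> yields multiples
    of the differential of \<open>dl\<close>, which drop out of the wedge product with it; only the
    differential of \<open>t\<close> survives.\<close>
  have cross: "d1 * (k^2 * (t2 * d^2 - u * (2 * d * d2)) / d^4) - d2 * (k^2 * (t1 * d^2 - u * (2 * d * d1)) / d^4)
      = k^2 / d^2 * (d1 * t2 - d2 * t1)" if "d \<noteq> 0" for d d1 d2 k t1 t2 u :: real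
    using that by (simp add: field_simps power2_eq_square power4_eq_xxxx)
  have pdh: "pd (det_theta_h F X) i x = (1 - a * b)^2 * (pd t i x * dl x ^ 2 - t x * (2 * dl x * pd dl i x)) / dl x ^ 4" for i
  proof -
    have "pd (det_theta_h F X) i x = pd (\<lambda>y. ((1 - a * b)^2 * t y) / (dl y * dl y)) i x"
      by (rule pd_cong[OF V x]) (simp add: deths(5) power2_eq_square)
    also have "\<dots> = (pd (\<lambda>y. (1 - a * b)^2 * t y) i x * (dl x * dl x)
        - (1 - a * b)^2 * t x * pd (\<lambda>y. dl y * dl y) i x) / (dl x * dl x)^2"
      by (rule pd_divide) (use frame[OF x] in \<open>auto intro!: differentiable_mult diff_t[OF x] diff_dl[OF x]\<close>)
    also have "pd (\<lambda>y. (1 - a * b)^2 * t y) i x = (1 - a * b)^2 * pd t i x"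
      using pd_scaleR_const[OF diff_t[OF x], of "(1 - a * b)^2" i] by simp
    also have "pd (\<lambda>y. dl y * dl y) i x = dl x * pd dl i x + pd dl i x * dl x"
      by (rule pd_mult[OF diff_dl[OF x] diff_dl[OF x]])
    finally show ?thesis unfolding quot .
  qed
  have "pd dl 1 x * pd (det_theta_h F X) 2 x - pd dl 2 x * pd (det_theta_h F X) 1 x
     = (1 - a * b)^2 / dl x ^ 2 * (pd dl 1 x * pd t 2 x - pd dl 2 x * pd t 1 x)"
    unfolding pdh by (rule cross[OF frame[OF x]])
  then have "pd dl 1 x * pd t 2 x - pd dl 2 x * pd t 1 x = 0"
    using dependent[OF x] kap frame[OF x] by simp
  then have "(a + b * t x) * dl x * wedge (pd t) la x = 0"
    unfolding pd_dl[OF x] wedge_def by (simp add: algebra_simps)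
  then have "wedge (pd t) la x = 0" using nz frame[OF x] by simp
  then have "n = t x * m x" using 1 be_ga[OF x] by simp
  then have "(a + b * t x) * m x = 0" using 2 by (simp add: algebra_simps)
  then show False using nz m_nonzero[OF x] by simp
qed

end

section \<open>The parallel scalar product\<close>

lemma pd_zero_constant_on_ball:
  fixes u :: "real^2 \<Rightarrow> real"
  assumes "ball x r \<subseteq> V" "\<And>y. y \<in> V \<Longrightarrow> u differentiable (at y)" "\<And>i y. y \<in> V \<Longrightarrow> pd u i y = 0"
    and y: "y \<in> ball x r"
  shows "u y = u x"
proof -
  have "(u has_derivative (\<lambda>h. 0)) (at z within ball x r)" if "z \<in> ball x r" for z
  proof -
    have z: "z \<in> V" using that assms(1) by blast
    have "(u has_derivative frechet_derivative u (at z)) (at z)" by (rule differentiable_hd[OF assms(2)[OF z]])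
    moreover have "frechet_derivative u (at z) = (\<lambda>h. 0)"
      using frechet_derivative_eq_pd[OF assms(2)[OF z]] assms(3)[OF z] by (simp add: fun_eq_iff)
    ultimately show ?thesis using has_derivative_at_withinI by metis
  qed
  then obtain c where "\<And>z. z \<in> ball x r \<Longrightarrow> u z = c"
    using has_derivative_zero_constant[OF convex_ball] by blast
  moreover have "x \<in> ball x r" using y by (metis centre_in_ball empty_iff ball_eq_empty not_le)
  ultimately show ?thesis using y by metis
qed

text \<open>Orthogonality of \<open>x\<close> to \<open>y - a *\<^sub>R x\<close> and of
  \<open>y\<close> to \<open>x - b *\<^sub>R y\<close>, the tangent directions besides
  \<open>w\<close>, fixes the ratios of the last three values. The scale makes
  \<open>x - b *\<^sub>R y\<close> a unit vector. The value on \<open>w\<close> stays open here;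
  \<open>adapted_form_value\<close> computes it.\<close>

definition adapted_form :: "real \<Rightarrow> real \<Rightarrow> real^3^3 \<Rightarrow> real^3 \<Rightarrow> real^3 \<Rightarrow> real^3 \<Rightarrow> bool" where
  "adapted_form a b Q w x y \<longleftrightarrow> transpose Q = Q \<and> bform Q w w \<noteq> 0 \<and> bform Q w x = 0 \<and> bform Q w y = 0
    \<and> bform Q x x = 1 / (1 - a * b) \<and> bform Q x y = a / (1 - a * b) \<and> bform Q y y = a / (b * (1 - a * b))"

text \<open>A kernel vector is expanded in the frame and paired with \<open>w\<close>,
  \<open>x\<close>, \<open>y\<close>; the Gram matrix of the frame is invertible.\<close>

lemma adapted_form_nondegenerate:
  assumes Q: "adapted_form a b Q w x y" and nz: "a \<noteq> 0" "b \<noteq> 0" "1 - a * b \<noteq> 0"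
    and d: "det3 w x y \<noteq> 0"
  shows "pseudo_scalar_product Q"
proof -
  note A = Q[unfolded adapted_form_def]
  have sym: "bform Q u v = bform Q v u" for u v using A bform_sym by blast
  have "z = 0" if "Q *v z = 0" for z
  proof -
    obtain p q r where z: "z = p *\<^sub>R w + q *\<^sub>R x + r *\<^sub>R y" using cramer3[OF d, of z] by blast
    have zero: "bform Q u z = 0" for u using that by (simp add: bform_def)
    have "p * bform Q w w = 0" using zero[of w] A by (simp add: z bform_linear)
    then have p: "p = 0" using A by simp
    have "(q + a * r) / (1 - a * b) = 0" using zero[of x] A sym[of x w] by (simp add: z p bform_linear add_divide_distrib mult.commute)
    then have q: "q = - a * r" using nz by simp
    have "a * q / (1 - a * b) + r * (a / (b * (1 - a * b))) = 0"
      using zero[of y] A sym[of y w] sym[of y x] by (simp add: z p bform_linear mult.commute)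
    moreover have "a * b * q + r * a = 0" if "a * q / k + r * (a / (b * k)) = 0" "k \<noteq> 0" for k
      using that nz(2) by (simp add: field_simps)
    ultimately have "a * b * q + r * a = 0" using nz(3) by blast
    then have "a * (1 - a * b) * r = 0" unfolding q by (simp add: algebra_simps)
    then have "r = 0" using nz by simp
    then show "z = 0" by (simp add: z p q)
  qed
  then have "\<exists>B. B ** Q = mat 1" using matrix_left_invertible_ker[of Q] by blast
  then have "invertible Q" using invertible_left_inverse by blast
  then show ?thesis using A by (simp add: pseudo_scalar_product_def invertible_det_nz)
qed

lemma bform_eqI:
  assumes "\<And>u v. bform Q u v = bform Q' u v"
  shows "Q = Q'"
proof -
  have "Q *v v = Q' *v v" for v
    using assms unfolding bform_def by (metis vector_eq_ldot)
  then show ?thesis by (simp add: matrix_eq)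
qed

context backlund_frame
begin

text \<open>Non-degeneracy makes \<open>t x\<close> nonzero, so \<open>a + b * t x = 0\<close>
  cannot hold with exactly one of \<open>a\<close>, \<open>b\<close> equal to zero.\<close>

lemma t_eq: "x \<in> V \<Longrightarrow> a \<noteq> 0 \<and> b \<noteq> 0 \<and> t x = - a / b"
proof -
  assume x: "x \<in> V"
  have tz: "t x \<noteq> 0" using deths(6)[OF x] al_be[OF x] by (simp add: t_def)
  have "b \<noteq> 0" using t_const[OF x] ab by auto
  moreover have "a \<noteq> 0" using t_const[OF x] tz \<open>b \<noteq> 0\<close> by auto
  moreover have "t x = - a / b" using t_const[OF x] \<open>b \<noteq> 0\<close> by (simp add: field_simps)
  ultimately show ?thesis by blast
qed

lemma pd_dl_zero: "x \<in> V \<Longrightarrow> pd dl i x = 0"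
  using pd_dl t_const by simp

lemma det_theta_h_eq: "x \<in> V \<Longrightarrow> det_theta_h F X x = (1 - a * b)^2 * (- a / b) / dl x ^ 2"
  using deths(5) t_eq by simp

text \<open>The factor of \<open>be\<close> is determined by equating the two expressions for
  \<open>ext al\<close>.\<close>

lemma rh_eq_m:
  assumes x: "x \<in> V"
  shows "rh i x = - a / b * m x * be i x"
proof -
  define n where "n = wedge rh ga x / wedge be ga x"
  note rh = rh_eq[OF x, folded n_def]
  let ?w = "wedge be ga x"
  have wed: "wedge be rh x = 0" "wedge be mu x = m x * ?w" "wedge ga mu x = 0" "wedge ga rh x = - n * ?w"
    by (simp_all add: wedge_def rh mu_eq[OF x] algebra_simps)
  have "(a * m x + b * n) * ?w = 0"
    using structure_equations(5,6)[OF x, unfolded wed] by (simp add: algebra_simps)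
  then have "a * m x + b * n = 0" using be_ga[OF x] by simp
  then have "n = - a / b * m x" using t_eq[OF x] by (simp add: field_simps)
  then show ?thesis using rh[of i] by simp
qed

text \<open>Exterior differentiation of \<open>mu = m ga\<close> and of
  \<open>rh = - a / b m be\<close>, combined with the structure equations, shows that the
  differential of \<open>m\<close> is parallel to \<open>ga\<close> and to
  \<open>be\<close>.\<close>

lemma pd_m_zero:
  assumes x: "x \<in> V"
  shows "pd m i x = 0"
proof -
  note S = structure_equations[OF x] and T = t_eq[OF x]
  define c where "c = a / b"
  have c: "c \<noteq> 0" "b * c = a" using T by (simp_all add: c_def)
  have forms: "si i x = - c * la i x" "rh i x = - c * m x * be i x" for i
    using si_eq[OF x] rh_eq_m[OF x] T by (simp_all add: c_def)
  have w: "wedge la rh x = c * m x * wedge be la x" "wedge la mu x = - m x * wedge ga la x"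
    "wedge be si x = - c * wedge be la x" "wedge ga si x = - c * wedge ga la x"
    "wedge si mu x = c * m x * wedge ga la x" "wedge si rh x = - (c^2) * m x * wedge be la x"
    by (simp_all add: wedge_def mu_eq[OF x] forms algebra_simps power2_eq_square)
  have "ext mu x = wedge (pd m) ga x + m x * ext ga x"
    by (rule ext_product[OF x mu_eq diff_m[OF x] diff_forms(3)[OF x]])
  then have "wedge (pd m) ga x = 0"
    using S(1,3,8,9) c(2) unfolding w by algebra
  moreover have "ext rh x = wedge (pd (\<lambda>y. - a / b * m y)) be x + - a / b * m x * ext be x"
    by (rule ext_product[OF x rh_eq_m _ diff_forms(2)[OF x]])
      (assumption, intro differentiable_mult differentiable_const diff_m[OF x])
  then have "ext rh x = - c * wedge (pd m) be x - c * m x * ext be x"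
    using pd_scaleR_const[OF diff_m[OF x], of "- a / b"] by (simp add: wedge_def c_def algebra_simps)
  then have "c * wedge (pd m) be x = 0"
    using S(1,3,7,10) c(2) unfolding w by algebra
  then have "wedge (pd m) be x = 0" using c by simp
  ultimately show ?thesis by (rule wedge_zeroD[OF x])
qed

text \<open>Up to a constant factor the inverse of the scalar product sought; unlike the latter it is a
  polynomial in the frame, so that its derivative is immediate.\<close>

definition "cometric k l y = - m y * (W y $ k * W y $ l) + X y $ k * X y $ l
  - b * (X y $ k * Y y $ l + Y y $ k * X y $ l) + b / a * (Y y $ k * Y y $ l)"

lemma cometric_differentiable: "x \<in> V \<Longrightarrow> cometric k l differentiable (at x)"
  unfolding cometric_def[abs_def]
  by (intro differentiable_add differentiable_diff differentiable_mult differentiable_minus differentiable_const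
      vec_nth_differentiable diff_m diffs diff_W[unfolded vector_minus_component[symmetric]])

text \<open>With \<open>m\<close> constant and \<open>mu\<close>, \<open>rh\<close>,
  \<open>si\<close> expressed through \<open>ga\<close>, \<open>be\<close>, \<open>la\<close>, the
  coefficients of all symmetric products of frame vectors cancel.\<close>

lemma pd_cometric_zero:
  assumes x: "x \<in> V"
  shows "pd (cometric k l) i x = 0"
proof -
  note D = diff_m[OF x] vec_nth_differentiable[OF diff_W[OF x]] vec_nth_differentiable[OF diffs(1)[OF x]]
    vec_nth_differentiable[OF diffs(2)[OF x]]
  have m: "pd (\<lambda>y. - m y) i x = 0" by (simp add: pd_minus D pd_m_zero[OF x])
  have W: "pd (\<lambda>y. W y $ k) i x = (ga i x + a * be i x) * X x $ k - (be i x + b * ga i x) * Y x $ k" for k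
    unfolding pd_vec_nth[OF diff_W[OF x]] pdW[OF x] by simp
  have X: "pd (\<lambda>y. X y $ k) i x = m x * ga i x * W x $ k + la i x * (Y x $ k - a * X x $ k)" for k
    unfolding pd_vec_nth[OF diffs(1)[OF x]] pdX[OF x] mu_eq[OF x] by simp
  have Y: "pd (\<lambda>y. Y y $ k) i x = - a / b * m x * be i x * W x $ k + - a / b * la i x * (X x $ k - b * Y x $ k)" for k
    unfolding pd_vec_nth[OF diffs(2)[OF x]] pdY[OF x] rh_eq_m[OF x] si_eq[OF x] using t_eq[OF x] by simp
  have "pd (cometric k l) i x = - m x * (W x $ k * pd (\<lambda>y. W y $ l) i x + pd (\<lambda>y. W y $ k) i x * W x $ l)
      + (X x $ k * pd (\<lambda>y. X y $ l) i x + pd (\<lambda>y. X y $ k) i x * X x $ l)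
      - b * (X x $ k * pd (\<lambda>y. Y y $ l) i x + pd (\<lambda>y. X y $ k) i x * Y x $ l
        + (Y x $ k * pd (\<lambda>y. X y $ l) i x + pd (\<lambda>y. Y y $ k) i x * X x $ l))
      + b / a * (Y x $ k * pd (\<lambda>y. Y y $ l) i x + pd (\<lambda>y. Y y $ k) i x * Y x $ l)"
    unfolding cometric_def[abs_def]
    by (simp only: pd_add pd_diff pd_mult D differentiable_add differentiable_diff differentiable_mult
        differentiable_minus differentiable_const m pd_const mult_zero_left add_0_right)
  also have "\<dots> = 0"
    unfolding W X Y using t_eq[OF x] by (simp add: field_simps)
  finally show ?thesis .
qed

text \<open>The cometric is a constant matrix \<open>P\<close> on a ball, and its inverse is the
  required form. Its values are obtained from explicit preimages of the frame vectors under
  \<open>P\<close>.\<close>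

lemma adapted_form_exists:
  assumes x: "x \<in> V"
  shows "\<exists>Q U. open U \<and> x \<in> U \<and> U \<subseteq> V \<and> (\<forall>y\<in>U. adapted_form a b Q (W y) (X y) (Y y))"
proof -
  obtain r where r: "r > 0" "ball x r \<subseteq> V" using V x openE by blast
  define P :: "real^3^3" where "P = (\<chi> k l. cometric k l x)"
  define Q where "Q = matrix_inv P"
  have P: "P $ k $ l = cometric k l y" if "y \<in> ball x r" for y k l
    unfolding P_def using pd_zero_constant_on_ball[OF r(2) cometric_differentiable pd_cometric_zero that] by simp
  have symP: "transpose P = P"
    unfolding P_def cometric_def by (simp add: transpose_def vec_eq_iff algebra_simps)
  have Pv: "P *v z = (- m y * (W y \<bullet> z)) *\<^sub>R W y + (X y \<bullet> z - b * (Y y \<bullet> z)) *\<^sub>R X y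
      + (b / a * (Y y \<bullet> z) - b * (X y \<bullet> z)) *\<^sub>R Y y" if "y \<in> ball x r" for y z
    unfolding vec_eq_iff matrix_vector_mult_def P[OF that] cometric_def
    by (simp add: inner_vec_def sum_3 algebra_simps)
  \<comment> \<open>The cross products divided by \<open>dl\<close> are the dual basis of the frame;
    the combinations have the prescribed Gram entries as coefficients, with \<open>- 1 / m\<close>
    for \<open>W\<close>.\<close>
  define pW pX pY where p: "pW y = (- 1 / (m y * dl y)) *\<^sub>R cross3 (X y) (Y y)"
    "pX y = (1 / (dl y * (1 - a * b))) *\<^sub>R (cross3 (Y y) (W y) + a *\<^sub>R cross3 (W y) (X y))"
    "pY y = (a / (b * (1 - a * b) * dl y)) *\<^sub>R (b *\<^sub>R cross3 (Y y) (W y) + cross3 (W y) (X y))" for y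
  have ab0: "a \<noteq> 0" "b \<noteq> 0" using t_eq[OF x] by auto
  have dots: "W y \<bullet> pW y = - 1 / m y" "X y \<bullet> pW y = 0" "Y y \<bullet> pW y = 0"
    "W y \<bullet> pX y = 0" "X y \<bullet> pX y = 1 / (1 - a * b)" "Y y \<bullet> pX y = a / (1 - a * b)"
    "W y \<bullet> pY y = 0" "X y \<bullet> pY y = a / (1 - a * b)" "Y y \<bullet> pY y = a / (b * (1 - a * b))"
    if "y \<in> V" for y
  proof -
    have cr: "u \<bullet> cross3 v w = det3 u v w" for u v w by (simp add: dot_cross_det det3_def)
    have d: "dl y \<noteq> 0" "m y \<noteq> 0" using frame[OF that] m_nonzero[OF that] by auto
    have zs: "det3 u u v = 0" "det3 u v u = 0" "det3 u v v = 0" for u v by (simp_all add: det3_linear)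
    have perm: "det3 (X y) (Y y) (W y) = dl y" "det3 (Y y) (W y) (X y) = dl y"
      using det3_perm by metis+
    show "W y \<bullet> pW y = - 1 / m y" "X y \<bullet> pW y = 0" "Y y \<bullet> pW y = 0"
      "W y \<bullet> pX y = 0" "X y \<bullet> pX y = 1 / (1 - a * b)" "Y y \<bullet> pX y = a / (1 - a * b)"
      "W y \<bullet> pY y = 0" "X y \<bullet> pY y = a / (1 - a * b)" "Y y \<bullet> pY y = a / (b * (1 - a * b))"
      unfolding p inner_scaleR_right inner_add_right cr zs perm using d ab0 kap by simp_all
  qed
  have images: "P *v pW y = W y" "P *v pX y = X y" "P *v pY y = Y y" if "y \<in> ball x r" for y
  proof -
    have y: "y \<in> V" using that r by blast
    have eqs: "1 / (1 - a * b) - b * (a / (1 - a * b)) = 1" "b / a * (a / (1 - a * b)) - b * (1 / (1 - a * b)) = 0"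
      "a / (1 - a * b) - b * (a / (b * (1 - a * b))) = 0" "b / a * (a / (b * (1 - a * b))) - b * (a / (1 - a * b)) = 1"
      using ab0 kap by (simp_all add: divide_simps)
    show "P *v pW y = W y" unfolding Pv[OF that] dots[OF y] using m_nonzero[OF y] by simp
    show "P *v pX y = X y" "P *v pY y = Y y" unfolding Pv[OF that] dots[OF y] eqs by simp_all
  qed
  have adj: "(P *v u) \<bullet> v = u \<bullet> (P *v v)" for u v
    by (metis dot_lmul_matrix symP transpose_matrix_vector)
  have xB: "x \<in> ball x r" using r by simp
  \<comment> \<open>The frame lies in the image of the symmetric matrix \<open>P\<close>, so a
    kernel vector is orthogonal to the frame and therefore to itself.\<close>
  have "z = 0" if z: "P *v z = 0" for z
  proof -
    have 0: "W x \<bullet> z = 0" "X x \<bullet> z = 0" "Y x \<bullet> z = 0"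
      using adj[of "pW x" z] adj[of "pX x" z] adj[of "pY x" z] unfolding images[OF xB] z by simp_all
    obtain p q r where "z = p *\<^sub>R W x + q *\<^sub>R X x + r *\<^sub>R Y x" using cramer3[OF frame[OF x], of z] by blast
    then have "z \<bullet> z = 0" using 0 by (metis inner_add_left inner_scaleR_left mult_zero_right add_0)
    then show ?thesis by simp
  qed
  then have "invertible P" using matrix_left_invertible_ker[of P] invertible_left_inverse by blast
  note inv = matrix_inv_inverse[OF this, folded Q_def]
  have Qf: "bform Q (P *v u) v = v \<bullet> u" for u v
    unfolding bform_def adj matrix_vector_mul_assoc inv by (simp add: inner_commute)
  have symQ: "transpose Q = Q"
  proof -
    have "transpose Q ** P = mat 1" using inv(1) symP by (metis matrix_transpose_mul transpose_mat)
    then show ?thesis by (metis inv(1) matrix_mul_assoc matrix_mul_lid matrix_mul_rid)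
  qed
  have "adapted_form a b Q (W y) (X y) (Y y)" if "y \<in> ball x r" for y
  proof -
    have y: "y \<in> V" using that r by blast
    have Q': "bform Q (W y) v = v \<bullet> pW y" "bform Q (X y) v = v \<bullet> pX y" "bform Q (Y y) v = v \<bullet> pY y" for v
      using Qf[of "pW y" v] Qf[of "pX y" v] Qf[of "pY y" v] unfolding images[OF that] by auto
    show ?thesis unfolding adapted_form_def Q' dots[OF y] using symQ m_nonzero[OF y] by simp
  qed
  then show ?thesis using r by (intro exI[of _ Q] exI[of _ "ball x r"]) auto
qed

text \<open>Differentiating the orthogonality of \<open>X\<close> and \<open>W\<close> gives
  \<open>ga i x * (1 + m x * bform Q (W x) (W x)) = 0\<close>, and \<open>ga\<close> does not vanish
  at \<open>x\<close>.\<close>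

lemma adapted_form_value:
  assumes U: "open U" "x \<in> U" "U \<subseteq> V" and Q: "\<forall>y\<in>U. adapted_form a b Q (W y) (X y) (Y y)"
  shows "bform Q (W x) (W x) = - 1 / m x"
proof -
  have x: "x \<in> V" using U by blast
  note A = bspec[OF Q U(2), unfolded adapted_form_def]
  have sym: "bform Q u v = bform Q v u" for u v using A bform_sym by blast
  have eq: "ga i x * (1 + m x * bform Q (W x) (W x)) = 0" for i
  proof -
    have "pd (\<lambda>y. bform Q (X y) (W y)) i x = pd (\<lambda>y. 0) i x"
      by (rule pd_cong[OF U(1,2)]) (use Q bform_sym in \<open>unfold adapted_form_def, metis\<close>)
    then have "bform Q (X x) (pd W i x) + bform Q (pd X i x) (W x) = 0"
      by (simp only: pd_bilinear[OF bform_bilinear diffs(1)[OF x] diff_W[OF x]] pd_const)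
    moreover have "bform Q (X x) (pd W i x) = ga i x"
    proof -
      have "bform Q (X x) (pd W i x) = (ga i x + a * be i x) / (1 - a * b) - (be i x + b * ga i x) * a / (1 - a * b)"
        unfolding pdW[OF x] bform_linear(4,6) using A by simp
      also have "\<dots> = (1 - a * b) * ga i x / (1 - a * b)"
        unfolding diff_divide_distrib[symmetric] by (simp add: algebra_simps)
      also have "\<dots> = ga i x" using kap by simp
      finally show ?thesis .
    qed
    moreover have "bform Q (pd X i x) (W x) = m x * ga i x * bform Q (W x) (W x)"
      unfolding pdX[OF x] mu_eq[OF x] bform_linear(1,5) bform_linear(3)[of Q "Y x" "a *\<^sub>R X x"]
        sym[of "X x" "W x"] sym[of "Y x" "W x"] using A by simp
    ultimately show ?thesis by (simp add: algebra_simps)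
  qed
  have "ga 1 x \<noteq> 0 \<or> ga 2 x \<noteq> 0" using be_ga[OF x] by (auto simp: wedge_def)
  then have "1 + m x * bform Q (W x) (W x) = 0" using eq[of 1] eq[of 2] by auto
  then show ?thesis using m_nonzero[OF x] by (simp add: field_simps add_eq_0_iff)
qed

text \<open>All products of frame vectors are prescribed, the last one by
  \<open>adapted_form_value\<close>. This is what glues the local forms together.\<close>

lemma adapted_form_unique:
  assumes U: "open U" "x \<in> U" "U \<subseteq> V" and Q: "\<forall>y\<in>U. adapted_form a b Q (W y) (X y) (Y y)"
    and Q': "\<forall>y\<in>U. adapted_form a b Q' (W y) (X y) (Y y)"
  shows "Q = Q'"
proof (rule bform_eqI)
  fix u v
  have x: "x \<in> V" using U by blast
  note A = bspec[OF Q U(2), unfolded adapted_form_def] and A' = bspec[OF Q' U(2), unfolded adapted_form_def]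
  have sym: "bform Q u v = bform Q v u" "bform Q' u v = bform Q' v u" for u v using A A' bform_sym by blast+
  have WW: "bform Q (W x) (W x) = bform Q' (W x) (W x)"
    using adapted_form_value[OF U Q] adapted_form_value[OF U Q'] by simp
  obtain p q r where u: "u = p *\<^sub>R W x + q *\<^sub>R X x + r *\<^sub>R Y x" using cramer3[OF frame[OF x], of u] by blast
  obtain p' q' r' where v: "v = p' *\<^sub>R W x + q' *\<^sub>R X x + r' *\<^sub>R Y x" using cramer3[OF frame[OF x], of v] by blast
  show "bform Q u v = bform Q' u v"
    unfolding u v bform_linear(1,2,5,6) sym[of "X x" "W x"] sym[of "Y x" "W x"] sym[of "Y x" "X x"] using A A' WW by simp
qed

text \<open>The derivative of \<open>W\<close> is a combination of \<open>X\<close> and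
  \<open>Y\<close>, both orthogonal to \<open>W\<close>.\<close>

lemma adapted_form_length:
  assumes Q: "\<forall>y\<in>V. adapted_form a b Q (W y) (X y) (Y y)" and x: "x \<in> V"
  shows "(\<lambda>y. bform Q (W y) (W y)) differentiable (at x)" "pd (\<lambda>y. bform Q (W y) (W y)) i x = 0"
proof -
  note A = bspec[OF Q x, unfolded adapted_form_def]
  have "bform Q (W x) (pd W i x) = 0" unfolding pdW[OF x] bform_linear(4,6) using A by simp
  moreover have "bform Q (pd W i x) (W x) = bform Q (W x) (pd W i x)" using A bform_sym by blast
  ultimately show "pd (\<lambda>y. bform Q (W y) (W y)) i x = 0"
    by (simp add: pd_bilinear[OF bform_bilinear diff_W[OF x] diff_W[OF x]])
  show "(\<lambda>y. bform Q (W y) (W y)) differentiable (at x)"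
    by (rule bilinear_differentiable[OF bform_bilinear diff_W[OF x] diff_W[OF x]])
qed

text \<open>The tangent planes have the orthogonal bases \<open>W\<close>, \<open>Y - a X\<close>
  and \<open>W\<close>, \<open>X - b Y\<close>, where the second vectors have squares
  \<open>a / b\<close> and 1. The metric determinants are the products of the squares times the
  squared change of basis.\<close>

lemma adapted_form_geometry:
  assumes Q: "\<forall>y\<in>V. adapted_form a b Q (W y) (X y) (Y y)" and x: "x \<in> V"
  shows "bform Q (X x) (pd F i x) = 0" "bform Q (Y x) (pd G i x) = 0"
    "indmet_det Q F x = wedge al be x ^ 2 * bform Q (W x) (W x) * (a / b)"
    "indmet_det Q G x = wedge al ga x ^ 2 * bform Q (W x) (W x)"
proof -
  note A = bspec[OF Q x, unfolded adapted_form_def]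
  have sym: "bform Q u v = bform Q v u" for u v using A bform_sym by blast
  note A' = A[unfolded sym[of "W x" "X x"] sym[of "W x" "Y x"] sym[of "X x" "Y x"]]
  have E: "bform Q (Y x - a *\<^sub>R X x) v = bform Q (Y x) v - a * bform Q (X x) v"
    "bform Q (X x - b *\<^sub>R Y x) v = bform Q (X x) v - b * bform Q (Y x) v"
    "bform Q v (Y x - a *\<^sub>R X x) = bform Q v (Y x) - a * bform Q v (X x)"
    "bform Q v (X x - b *\<^sub>R Y x) = bform Q v (X x) - b * bform Q v (Y x)" for v
    by (simp_all add: bform_linear)
  show "bform Q (X x) (pd F i x) = 0" "bform Q (Y x) (pd G i x) = 0"
    unfolding pdF[OF x] pdG[OF x] bform_linear(2,6) E using A A' t_eq[OF x] by simp_all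
  define k where "k = 1 - a * b"
  have k: "k \<noteq> 0" using kap by (simp add: k_def)
  have vals: "bform Q (X x) (X x) = 1 / k" "bform Q (X x) (Y x) = a / k" "bform Q (Y x) (X x) = a / k"
    "bform Q (Y x) (Y x) = a / (b * k)" using A A' by (simp_all add: k_def)
  have EE: "bform Q (Y x - a *\<^sub>R X x) (Y x - a *\<^sub>R X x) = a / b"
    unfolding E vals using k t_eq[OF x] by (simp add: divide_simps) (simp add: k_def algebra_simps)
  have EE': "bform Q (X x - b *\<^sub>R Y x) (X x - b *\<^sub>R Y x) = 1"
    unfolding E vals using k t_eq[OF x] by (simp add: divide_simps) (simp add: k_def algebra_simps)
  have cr: "bform Q (W x) (Y x - a *\<^sub>R X x) = 0" "bform Q (Y x - a *\<^sub>R X x) (W x) = 0"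
    "bform Q (W x) (X x - b *\<^sub>R Y x) = 0" "bform Q (X x - b *\<^sub>R Y x) (W x) = 0"
    unfolding E using A A' by simp_all
  show "indmet_det Q F x = wedge al be x ^ 2 * bform Q (W x) (W x) * (a / b)"
    unfolding indmet_det_def indmet_def pdF[OF x] bform_linear(1,2,5,6) EE cr wedge_def by algebra
  show "indmet_det Q G x = wedge al ga x ^ 2 * bform Q (W x) (W x)"
    unfolding indmet_det_def indmet_def pdG[OF x] bform_linear(1,2,5,6) EE' cr wedge_def by algebra
qed

text \<open>\<open>sect_curv_eq\<close> is evaluated with the formulas for \<open>deth\<close> and
  for the metric determinants; the wedge products cancel.\<close>

lemma adapted_form_curvature:
  assumes Q: "\<forall>y\<in>V. adapted_form a b Q (W y) (X y) (Y y)" and x: "x \<in> V"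
    and tau: "\<And>i. tau F X i x = 0" "\<And>i. tau G Y i x = 0"
  shows "indmet_det Q F x \<noteq> 0" "indmet_det Q G x \<noteq> 0"
    "sect_curv Q F x = - (1 - a * b) / bform Q (W x) (W x)"
    "sect_curv Q G x = - (1 - a * b) / bform Q (W x) (W x)"
proof -
  note A = bspec[OF Q x, unfolded adapted_form_def] and g = adapted_form_geometry[OF Q]
  have ndF: "indmet_det Q F y \<noteq> 0" if "y \<in> V" for y
    using g(3)[OF that] t_eq[OF that] al_be[OF that] bspec[OF Q that] unfolding adapted_form_def by simp
  have ndG: "indmet_det Q G y \<noteq> 0" if "y \<in> V" for y
    using g(4)[OF that] al_ga[OF that] bspec[OF Q that] unfolding adapted_form_def by simp
  have volF: "vol F X y \<noteq> 0" and volG: "vol G Y y \<noteq> 0" if "y \<in> V" for y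
    using deths(1,2)[OF that] al_be[OF that] al_ga[OF that] frame[OF that] by simp_all
  show "indmet_det Q F x \<noteq> 0" "indmet_det Q G x \<noteq> 0" using ndF ndG x by blast+
  have symQ: "transpose Q = Q" using A by blast
  define w where "w = bform Q (W x) (W x)"
  have w: "w \<noteq> 0" using A by (simp add: w_def)
  have tx: "wedge ga si x = - a / b * wedge al be x"
    using t_eq[OF x] al_be[OF x] unfolding t_def by (metis nonzero_mult_div_cancel_right times_divide_eq_left)
  \<comment> \<open>The relation \<open>deths(7)\<close> converts the value of
    \<open>wedge ga si x\<close> into that of \<open>wedge be la x\<close>, which occurs in
    \<open>deth G Y x\<close>.\<close>
  have "wedge al be x * (- a / b * wedge be la x) = wedge al be x * (- wedge al ga x)"
    using deths(7)[OF x] unfolding tx by (simp add: ac_simps)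
  then have "- a / b * wedge be la x = - wedge al ga x" using al_be[OF x] mult_left_cancel by blast
  then have ty: "wedge be la x = b / a * wedge al ga x" using t_eq[OF x] by (simp add: field_simps)
  have "sect_curv Q F x = bform Q (X x) (X x) * deth F X x / indmet_det Q F x"
    by (rule sect_curv_eq[OF V x sm(1,3) volF tau(1) symQ g(1) ndF])
  also have "\<dots> = 1 / (1 - a * b) * ((1 - a * b)^2 * wedge al be x * (- a / b * wedge al be x))
      / (wedge al be x ^ 2 * w * (a / b))"
    unfolding deths[OF x] g(3)[OF x] tx using A by (simp add: w_def)
  also have "\<dots> = - (1 - a * b) / w"
    using w kap al_be[OF x] t_eq[OF x] by (simp add: divide_simps) (simp add: algebra_simps power2_eq_square)
  finally show "sect_curv Q F x = - (1 - a * b) / bform Q (W x) (W x)" by (simp add: w_def)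
  have "sect_curv Q G x = bform Q (Y x) (Y x) * deth G Y x / indmet_det Q G x"
    by (rule sect_curv_eq[OF V x sm(2,4) volG tau(2) symQ g(2) ndG])
  also have "\<dots> = a / (b * (1 - a * b)) * (- ((1 - a * b)^2) * wedge al ga x * (b / a * wedge al ga x))
      / (wedge al ga x ^ 2 * w)"
    unfolding deths[OF x] g(4)[OF x] ty using A by (simp add: w_def)
  also have "\<dots> = - (1 - a * b) / w"
    using w kap al_ga[OF x] t_eq[OF x] by (simp add: divide_simps) (simp add: algebra_simps power2_eq_square)
  finally show "sect_curv Q G x = - (1 - a * b) / bform Q (W x) (W x)" by (simp add: w_def)
qed

end

section \<open>Existence of the frame and passage to the manifold\<close>

lemma det3_plane:
  "det3 (p1 *\<^sub>R u + r1 *\<^sub>R v) (p2 *\<^sub>R u + r2 *\<^sub>R v) w = (p1 * r2 - p2 * r1) * det3 u v w"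
  by (simp add: det3_linear det3_perm(1)[of v u] algebra_simps)

lemma sgn_differentiable:
  fixes w :: "'a::euclidean_space"
  assumes "w \<noteq> 0"
  shows "sgn differentiable (at w)"
proof -
  have "(\<lambda>v. inverse (norm v) *\<^sub>R v) differentiable (at w)"
    using assms by (intro scaleR_differentiable differentiable_inverse differentiable_norm_at) auto
  then show ?thesis by (simp add: sgn_div_norm[abs_def])
qed

text \<open>A nonzero kernel vector makes the two partials linearly dependent, so the image would be
  at most a line.\<close>

lemma rank_2_kernel:
  fixes N :: "real^2 \<Rightarrow> real^3"
  assumes d: "N differentiable (at x)" and r: "dim (range (frechet_derivative N (at x))) = 2"
    and v: "frechet_derivative N (at x) v = 0"
  shows "v = 0"
proof (rule ccontr)
  assume "v \<noteq> 0"
  note eq = frechet_derivative_eq_pd[OF d]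
  have "\<exists>z. range (frechet_derivative N (at x)) \<subseteq> span {z}"
  proof (cases "v $ 1 = 0")
    case True
    then have "v $ 2 \<noteq> 0" using \<open>v \<noteq> 0\<close> by (simp add: vec_eq_iff forall_2)
    then have "pd N 2 x = 0" using v True by (simp add: eq)
    then have "range (frechet_derivative N (at x)) \<subseteq> span {pd N 1 x}"
      by (auto simp: eq span_singleton)
    then show ?thesis by blast
  next
    case False
    have "pd N 1 x = (1 / v $ 1) *\<^sub>R (v $ 1 *\<^sub>R pd N 1 x)" using False by simp
    also have "v $ 1 *\<^sub>R pd N 1 x = - (v $ 2 *\<^sub>R pd N 2 x)"
      using v by (simp add: eq eq_neg_iff_add_eq_0)
    finally have "frechet_derivative N (at x) u = (u $ 2 - u $ 1 * v $ 2 / v $ 1) *\<^sub>R pd N 2 x" for u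
      by (simp add: eq algebra_simps)
    then have "range (frechet_derivative N (at x)) \<subseteq> span {pd N 2 x}"
      by (auto simp: span_singleton)
    then show ?thesis by blast
  qed
  then obtain z where "range (frechet_derivative N (at x)) \<subseteq> span {z}" by blast
  then have "dim (range (frechet_derivative N (at x))) \<le> card {z}" by (intro dim_le_card) auto
  then show False using r by simp
qed

text \<open>Normalising by \<open>sgn\<close> lifts the map to the projective plane locally to the
  sphere. A direction annihilated by the derivative of \<open>W\<close> is annihilated after
  normalising too, so \<open>A\<close> and \<open>B\<close> have no common nonzero kernel
  vector.\<close>

lemma projective_rank_independent:
  fixes W :: "real^2 \<Rightarrow> real^3" and A B :: "2 \<Rightarrow> real"
  assumes d: "W differentiable (at x)" and W: "W x \<noteq> 0"
    and r: "dim (range (frechet_derivative (\<lambda>y. sgn (W y)) (at x))) = 2"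
    and pdW: "\<And>i. pd W i x = A i *\<^sub>R u - B i *\<^sub>R w"
  shows "A 1 * B 2 - A 2 * B 1 \<noteq> 0"
proof
  assume z: "A 1 * B 2 - A 2 * B 1 = 0"
  have ker: "v = 0" if v: "v $ 1 * A 1 + v $ 2 * A 2 = 0" "v $ 1 * B 1 + v $ 2 * B 2 = 0" for v :: "real^2"
  proof -
    have "frechet_derivative W (at x) v = (v $ 1 * A 1 + v $ 2 * A 2) *\<^sub>R u - (v $ 1 * B 1 + v $ 2 * B 2) *\<^sub>R w"
      unfolding frechet_derivative_eq_pd[OF d] pdW by (simp add: algebra_simps)
    then have 0: "frechet_derivative W (at x) v = 0" using v by simp
    obtain S where S: "(sgn has_derivative S) (at (W x))"
      using sgn_differentiable[OF W] unfolding differentiable_def by blast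
    have comp: "((\<lambda>y. sgn (W y)) has_derivative (\<lambda>h. S (frechet_derivative W (at x) h))) (at x)"
      using has_derivative_compose[OF differentiable_hd[OF d] S] .
    have "frechet_derivative (\<lambda>y. sgn (W y)) (at x) v = S 0"
      using frechet_derivative_at[OF comp] 0 by metis
    also have "S 0 = 0" using S has_derivative_linear linear_0 by blast
    finally show ?thesis
      using rank_2_kernel[OF differentiableI[OF comp] r] by blast
  qed
  \<comment> \<open>For proportional \<open>A\<close> and \<open>B\<close> these two vectors lie in
    both kernels, hence vanish. Then \<open>A\<close> and \<open>B\<close> are zero and every vector
    is in the kernel.\<close>
  have "(vector [A 2, - A 1] :: real^2) = 0" "(vector [B 2, - B 1] :: real^2) = 0"
    using z by (auto intro!: ker simp: algebra_simps)
  then have "A 1 = 0" "A 2 = 0" "B 1 = 0" "B 2 = 0" by (auto simp: vec_eq_iff forall_2)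
  then have "(vector [1, 0] :: real^2) = 0" by (intro ker) auto
  then show False by (simp add: vec_eq_iff forall_2)
qed

lemma conormal_range:
  assumes "F differentiable (at x)" "v \<in> range (frechet_derivative F (at x))"
  shows "conormal F X x v = 0"
proof -
  obtain h :: "real^2" where "v = h $ 1 *\<^sub>R pd F 1 x + h $ 2 *\<^sub>R pd F 2 x"
    using assms(2) frechet_derivative_eq_pd[OF assms(1)] by auto
  then show ?thesis
    using conormal_linear[of F X x] conormal_tangent[of F X x] by (simp add: linear_add linear_scale)
qed

text \<open>Each tangent plane is the kernel of its conormal and contains \<open>W\<close>, and by
  equiaffinity the derivatives of the transversal field lie in it as well.
  \<open>hyperplane_decomposition\<close> then yields the one-forms as Cramer quotients, which are
  differentiable.\<close>

lemma backlund_frame_exists: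
  fixes F G X Y :: "real^2 \<Rightarrow> real^3"
  assumes V: "open V" "V \<noteq> {}"
    and sm: "smooth_on F V" "smooth_on G V" "smooth_on X V" "smooth_on Y V"
    and vol: "\<And>y. y \<in> V \<Longrightarrow> vol F X y \<noteq> 0" "\<And>y. y \<in> V \<Longrightarrow> vol G Y y \<noteq> 0"
    and tau: "\<And>i y. y \<in> V \<Longrightarrow> tau F X i y = 0" "\<And>i y. y \<in> V \<Longrightarrow> tau G Y i y = 0"
    and tangent: "\<And>y. y \<in> V \<Longrightarrow> G y - F y \<in> range (frechet_derivative F (at y))"
      "\<And>y. y \<in> V \<Longrightarrow> G y - F y \<in> range (frechet_derivative G (at y))"
    and rank: "\<And>y. y \<in> V \<Longrightarrow> dim (range (frechet_derivative (\<lambda>y. sgn (G y - F y)) (at y))) = 2"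
    and frame: "\<And>y. y \<in> V \<Longrightarrow> det3 (G y - F y) (X y) (Y y) \<noteq> 0"
    and con: "\<And>y. y \<in> V \<Longrightarrow> conormal F X y (Y y) = a" "\<And>y. y \<in> V \<Longrightarrow> conormal G Y y (X y) = b"
    and c6: "\<And>i y. y \<in> V \<Longrightarrow> det3 (pd F i y) (X y) (Y y) = det3 (pd G i y) (X y) (Y y)"
    and rest: "\<And>y. y \<in> V \<Longrightarrow> deth F X y \<noteq> 0"
      "\<And>y. y \<in> V \<Longrightarrow> det3 (G y - F y) (X y) (Y y) ^ 4 * det_theta_h F X y * det_theta_h G Y y = (1 - a * b) ^ 4"
      "\<And>y. y \<in> V \<Longrightarrow> pd (\<lambda>y. det3 (G y - F y) (X y) (Y y)) 1 y * pd (det_theta_h F X) 2 y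
        = pd (\<lambda>y. det3 (G y - F y) (X y) (Y y)) 2 y * pd (det_theta_h F X) 1 y"
      "\<And>y. y \<in> V \<Longrightarrow> dim_im_curv (christ F X) y = 2"
      "a \<noteq> 0 \<or> b \<noteq> 0"
  shows "\<exists>al be ga mu la rh si. backlund_frame V F G X Y a b al be ga mu la rh si"
proof -
  let ?W = "\<lambda>y. G y - F y"
  let ?d = "\<lambda>y. det3 (?W y) (X y) (Y y)" and ?e = "\<lambda>y. det3 (?W y) (Y y) (X y)"
  define al be ga mu la rh si :: "2 \<Rightarrow> real^2 \<Rightarrow> real" where forms:
    "al = (\<lambda>i y. det3 (pd F i y) (X y) (Y y) / ?d y)" "be = (\<lambda>i y. det3 (?W y) (X y) (pd F i y) / ?d y)"
    "ga = (\<lambda>i y. det3 (?W y) (Y y) (pd G i y) / ?e y)"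
    "mu = (\<lambda>i y. det3 (pd X i y) (X y) (Y y) / ?d y)" "la = (\<lambda>i y. det3 (?W y) (X y) (pd X i y) / ?d y)"
    "rh = (\<lambda>i y. det3 (pd Y i y) (Y y) (X y) / ?e y)" "si = (\<lambda>i y. det3 (?W y) (Y y) (pd Y i y) / ?e y)"
  have ed: "?e y = - ?d y" for y by (rule det3_perm(3))
  have e: "?e y \<noteq> 0" if "y \<in> V" for y using frame[OF that] by (simp add: ed)
  note D = smooth_onD[OF sm(1)] smooth_onD[OF sm(2)] smooth_onD[OF sm(3)] smooth_onD[OF sm(4)]
  have diff: "al i differentiable (at y)" "be i differentiable (at y)" "ga i differentiable (at y)"
    "mu i differentiable (at y)" "la i differentiable (at y)" "rh i differentiable (at y)" "si i differentiable (at y)"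
    if "y \<in> V" for i y
    unfolding forms using that
    by (intro differentiable_divide det3_differentiable differentiable_diff D frame[OF that] e[OF that]; assumption)+
  have conW: "conormal F X y (?W y) = 0" "conormal G Y y (?W y) = 0" if "y \<in> V" for y
    using conormal_range[OF D(1)[OF that] tangent(1)[OF that]] conormal_range[OF D(4)[OF that] tangent(2)[OF that]] by auto
  have pdF: "pd F i y = al i y *\<^sub>R ?W y + be i y *\<^sub>R (Y y - a *\<^sub>R X y)"
    and pdX: "pd X i y = mu i y *\<^sub>R ?W y + la i y *\<^sub>R (Y y - a *\<^sub>R X y)" if y: "y \<in> V" for i y
  proof -
    note h = hyperplane_decomposition[OF conormal_linear conW(1)[OF y] conormal_transversal[OF vol(1)[OF y]] con(1)[OF y] _ frame[OF y]]
    show "pd F i y = al i y *\<^sub>R ?W y + be i y *\<^sub>R (Y y - a *\<^sub>R X y)"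
      unfolding forms by (rule h[OF conormal_tangent])
    show "pd X i y = mu i y *\<^sub>R ?W y + la i y *\<^sub>R (Y y - a *\<^sub>R X y)"
      unfolding forms by (rule h) (rule tau(1)[OF y, unfolded tau_def])
  qed
  have pdG: "pd G i y = al i y *\<^sub>R ?W y + ga i y *\<^sub>R (X y - b *\<^sub>R Y y)"
    and pdY: "pd Y i y = rh i y *\<^sub>R ?W y + si i y *\<^sub>R (X y - b *\<^sub>R Y y)" if y: "y \<in> V" for i y
  proof -
    note h = hyperplane_decomposition[OF conormal_linear conW(2)[OF y] conormal_transversal[OF vol(2)[OF y]] con(2)[OF y] _ e[OF y]]
    \<comment> \<open>The sixth assumption: the \<open>W\<close>-coefficients of the two immersions
      agree.\<close>
    have "al i y = det3 (pd G i y) (Y y) (X y) / ?e y"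
      unfolding forms c6[OF y] ed using det3_perm(3)[of "pd G i y" "Y y" "X y"] by simp
    then show "pd G i y = al i y *\<^sub>R ?W y + ga i y *\<^sub>R (X y - b *\<^sub>R Y y)"
      using h[OF conormal_tangent, of i] by (simp add: forms(3))
    show "pd Y i y = rh i y *\<^sub>R ?W y + si i y *\<^sub>R (X y - b *\<^sub>R Y y)"
      unfolding forms by (rule h) (rule tau(2)[OF y, unfolded tau_def])
  qed
  have rk: "(1 - a * b) * wedge be ga y \<noteq> 0" if y: "y \<in> V" for y
  proof -
    have dW: "?W differentiable (at y)" by (intro differentiable_diff D y)
    have "pd ?W i y = (ga i y + a * be i y) *\<^sub>R X y - (be i y + b * ga i y) *\<^sub>R Y y" for i
      by (subst pd_diff) (auto intro: D[OF y] simp: pdF[OF y] pdG[OF y] algebra_simps)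
    moreover have "?W y \<noteq> 0" using frame[OF y] by (auto simp: det3_expand)
    \<comment> \<open>Expanded, this expression is
      \<open>- (1 - a * b) * wedge be ga y\<close>.\<close>
    ultimately have "(ga 1 y + a * be 1 y) * (be 2 y + b * ga 2 y) - (ga 2 y + a * be 2 y) * (be 1 y + b * ga 1 y) \<noteq> 0"
      by (intro projective_rank_independent[where A = "\<lambda>i. ga i y + a * be i y" and B = "\<lambda>i. be i y + b * ga i y",
            OF dW _ rank[OF y]])
    then show ?thesis by (auto simp: wedge_def algebra_simps)
  qed
  have kap: "1 - a * b \<noteq> 0" using V(2) rk by fastforce
  have be_ga: "wedge be ga y \<noteq> 0" if "y \<in> V" for y using rk[OF that] by auto
  have al_be: "wedge al be y \<noteq> 0" if "y \<in> V" for y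
    using vol(1)[OF that] unfolding vol_def pdF[OF that] det3_plane wedge_def by auto
  have al_ga: "wedge al ga y \<noteq> 0" if "y \<in> V" for y
    using vol(2)[OF that] unfolding vol_def pdG[OF that] det3_plane wedge_def by auto
  have "backlund_frame V F G X Y a b al be ga mu la rh si"
    by unfold_locales (fact V sm diff pdF pdG pdX pdY frame kap be_ga al_be al_ga rest)+
  then show ?thesis by blast
qed

section \<open>Rescaling a transversal field\<close>

lemma smooth_on_scaleR:
  assumes V: "open V" and X: "smooth_on X V"
  shows "smooth_on (\<lambda>y. (s::real) *\<^sub>R X y) V"
proof -
  have eq: "dpart is (\<lambda>y. s *\<^sub>R X y) x = s *\<^sub>R dpart is X x" if "x \<in> V" for "is" x
    using that
  proof (induction "is" arbitrary: x)
    case (Cons i "is")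
    have "pd (dpart is (\<lambda>y. s *\<^sub>R X y)) i x = pd (\<lambda>y. s *\<^sub>R dpart is X y) i x"
      by (rule pd_cong[OF V Cons.prems Cons.IH])
    then show ?case using pd_scaleR_const[OF smooth_on_dpart[OF X Cons.prems], of s "is" i] by simp
  qed simp
  show ?thesis
    unfolding smooth_on_def
  proof (intro allI ballI)
    fix "is" x assume x: "x \<in> V"
    show "dpart is (\<lambda>y. s *\<^sub>R X y) differentiable (at x)"
      by (rule differentiable_cong_open[OF V x eq linear_differentiable[OF bounded_linear_scaleR_right
              smooth_on_dpart[OF X x]]])
  qed
qed

text \<open>The fundamental form is divided by \<open>s\<close> and the volume form multiplied by
  \<open>s\<close>; each contributes a factor \<open>s^2\<close> to the denominator.\<close>

lemma det_theta_h_scaleR: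
  assumes "s \<noteq> 0"
  shows "det_theta_h F (\<lambda>y. s *\<^sub>R X y) x = det_theta_h F X x / s ^ 4"
proof -
  have vol: "vol F (\<lambda>y. s *\<^sub>R X y) x = s * vol F X x" by (simp add: vol_def det3_linear)
  have afh: "afh F (\<lambda>y. s *\<^sub>R X y) i j x = afh F X i j x / s" for i j
    by (simp add: afh_def conormal_def vol mult.commute)
  have "deth F (\<lambda>y. s *\<^sub>R X y) x = deth F X x / s^2"
    unfolding deth_def afh by (simp add: power2_eq_square diff_divide_distrib)
  then show ?thesis
    unfolding det_theta_h_def vol by (simp add: power2_eq_square power4_eq_xxxx)
qed

section \<open>Charts, locally constant functions and the affine normal\<close>

lemma chart_facts:
  assumes "is_chart (fst c) (snd c)"
  shows "open (cdom c)" "p \<in> fst c \<Longrightarrow> snd c p \<in> cdom c" "p \<in> fst c \<Longrightarrow> loc c g (snd c p) = g p"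
    "open U \<Longrightarrow> open {p \<in> fst c. snd c p \<in> U}"
    "open N \<Longrightarrow> open (snd c ` (N \<inter> fst c))"
proof -
  let ?\<psi> = "inv_into (fst c) (snd c)"
  note ch = assms[unfolded is_chart_def]
  have h: "continuous_on (fst c) (snd c)" "continuous_on (cdom c) ?\<psi>" "\<And>p. p \<in> fst c \<Longrightarrow> ?\<psi> (snd c p) = p"
    using ch unfolding homeomorphism_def cdom_def by auto
  show o: "open (cdom c)" using ch by (simp add: cdom_def)
  show "p \<in> fst c \<Longrightarrow> snd c p \<in> cdom c" by (simp add: cdom_def)
  show "p \<in> fst c \<Longrightarrow> loc c g (snd c p) = g p" by (simp add: loc_def h(3))
  show "open {p \<in> fst c. snd c p \<in> U}" if "open U"
  proof -
    have "open (snd c -` U \<inter> fst c)" using h(1) ch that continuous_on_open_vimage by blast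
    moreover have "snd c -` U \<inter> fst c = {p \<in> fst c. snd c p \<in> U}" by auto
    ultimately show ?thesis by simp
  qed
  show "open (snd c ` (N \<inter> fst c))" if "open N"
  proof -
    have "open (?\<psi> -` N \<inter> cdom c)" using h(2) o that continuous_on_open_vimage by blast
    moreover have "?\<psi> -` N \<inter> cdom c = snd c ` (N \<inter> fst c)" using h(3) by (auto simp: cdom_def)
    ultimately show ?thesis by simp
  qed
qed

lemma locally_constant_eq:
  fixes u :: "'m::topological_space \<Rightarrow> 'b"
  assumes "connected (UNIV :: 'm set)" "\<And>p. \<exists>N. open N \<and> p \<in> N \<and> (\<forall>q\<in>N. u q = u p)"
  shows "\<exists>c. \<forall>p. u p = c"
proof -
  have "u constant_on UNIV"
    by (rule locally_constant_imp_constant[OF assms(1)]) (use assms(2) in auto)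
  then show ?thesis by (auto simp: constant_on_def)
qed

lemma smooth_atlas_chart:
  assumes "smooth_atlas A"
  shows "c \<in> A \<Longrightarrow> is_chart (fst c) (snd c)" "\<exists>c\<in>A. p \<in> fst c"
proof -
  show "c \<in> A \<Longrightarrow> is_chart (fst c) (snd c)" using assms unfolding smooth_atlas_def by blast
  have "p \<in> \<Union>(fst ` A)" using assms unfolding smooth_atlas_def by (metis UNIV_I)
  then show "\<exists>c\<in>A. p \<in> fst c" by blast
qed

text \<open>Constancy on a coordinate ball, by convexity, makes \<open>u\<close> locally constant;
  connectedness does the rest.\<close>

lemma zero_derivative_constant:
  fixes u :: "'m::topological_space \<Rightarrow> real"
  assumes A: "smooth_atlas A" and conn: "connected (UNIV :: 'm set)"
    and d: "\<And>c x. c \<in> A \<Longrightarrow> x \<in> cdom c \<Longrightarrow> loc c u differentiable (at x)"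
    and z: "\<And>c x i. c \<in> A \<Longrightarrow> x \<in> cdom c \<Longrightarrow> pd (loc c u) i x = 0"
  shows "\<exists>k. \<forall>p. u p = k"
proof (rule locally_constant_eq[OF conn])
  fix p
  obtain c where c: "c \<in> A" "p \<in> fst c" using smooth_atlas_chart(2)[OF A] by blast
  note ch = chart_facts[OF smooth_atlas_chart(1)[OF A c(1)]]
  obtain r where r: "r > 0" "ball (snd c p) r \<subseteq> cdom c" using ch(1) ch(2)[OF c(2)] openE by blast
  have "u q = u p" if "q \<in> fst c" "snd c q \<in> ball (snd c p) r" for q
    using pd_zero_constant_on_ball[OF r(2) d[OF c(1)] z[OF c(1)] that(2)] ch(3)[OF that(1), of u] ch(3)[OF c(2), of u] by simp
  then have "\<forall>q\<in>{q \<in> fst c. snd c q \<in> ball (snd c p) r}. u q = u p" by blast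
  moreover have "p \<in> {q \<in> fst c. snd c q \<in> ball (snd c p) r}" using c(2) r(1) by simp
  ultimately show "\<exists>N. open N \<and> p \<in> N \<and> (\<forall>q\<in>N. u q = u p)"
    using ch(4)[OF open_ball] by blast
qed

text \<open>Scaling by the fourth root of the absolute value of \<open>k\<close> turns
  \<open>det_theta_h\<close> into the sign of \<open>k\<close>. A constant factor keeps
  \<open>tau\<close> zero.\<close>

lemma affine_normal_exists:
  assumes A: "smooth_atlas A" and eq: "equiaffine_transversal A f \<xi>"
    and k: "k \<noteq> 0" "\<And>c x. c \<in> A \<Longrightarrow> x \<in> cdom c \<Longrightarrow> det_theta_h (loc c f) (loc c \<xi>) x = k"
  shows "\<exists>\<eta>. affine_normal A f \<eta> \<and> (\<forall>p. \<eta> p \<in> span {\<xi> p})"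
proof -
  define s where "s = root 4 \<bar>k\<bar>"
  have s: "s \<noteq> 0" "s ^ 4 = \<bar>k\<bar>" using k(1) by (simp_all add: s_def)
  define \<eta> where "\<eta> p = s *\<^sub>R \<xi> p" for p
  have loc: "loc c \<eta> = (\<lambda>y. s *\<^sub>R loc c \<xi> y)" for c by (simp add: loc_def \<eta>_def fun_eq_iff)
  have "smooth_map A \<eta>"
    unfolding smooth_map_def loc
  proof
    fix c assume c: "c \<in> A"
    show "smooth_on (\<lambda>y. s *\<^sub>R loc c \<xi> y) (cdom c)"
      using eq c unfolding equiaffine_transversal_def smooth_map_def
      by (intro smooth_on_scaleR chart_facts(1) smooth_atlas_chart[OF A]) auto
  qed
  moreover have "vol (loc c f) (loc c \<eta>) x \<noteq> 0 \<and> (\<forall>i. tau (loc c f) (loc c \<eta>) i x = 0)"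
    if c: "c \<in> A" "x \<in> cdom c" for c x
  proof -
    have E: "smooth_on (loc c \<xi>) (cdom c)" "vol (loc c f) (loc c \<xi>) x \<noteq> 0" "\<And>i. tau (loc c f) (loc c \<xi>) i x = 0"
      using eq c unfolding equiaffine_transversal_def smooth_map_def by auto
    have "pd (loc c \<eta>) i x = s *\<^sub>R pd (loc c \<xi>) i x" for i
      unfolding loc by (rule pd_scaleR_const[OF smooth_onD(1)[OF E(1) c(2)]])
    then show ?thesis
      using E(2,3) s(1) unfolding tau_def conormal_def vol_def loc by (simp add: det3_linear)
  qed
  moreover have "\<bar>det_theta_h (loc c f) (loc c \<eta>) x\<bar> = 1" if "c \<in> A" "x \<in> cdom c" for c x
    unfolding loc det_theta_h_scaleR[OF s(1)] k(2)[OF that] s(2) using k(1) by simp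
  ultimately have "affine_normal A f \<eta>"
    unfolding affine_normal_def equiaffine_transversal_def by blast
  moreover have "\<forall>p. \<eta> p \<in> span {\<xi> p}" by (simp add: \<eta>_def span_base span_scale)
  ultimately show ?thesis by blast
qed

theorem theorem5p2:
  fixes A :: "('m::{t2_space, second_countable_topology}) chart set"
    and f fh \<xi> \<xi>h :: "'m \<Rightarrow> real^3"
  assumes atlas: "smooth_atlas A"
    and conn: "connected (UNIV :: 'm set)"
    and imm: "immersion A f" "immersion A fh"
    and eqa: "equiaffine_transversal A f \<xi>" "equiaffine_transversal A fh \<xi>h"
    and nd: "nondegenerate A f \<xi>" "nondegenerate A fh \<xi>h"
    and c1: "\<forall>p. f p \<noteq> fh p"
            "\<forall>c\<in>A. \<forall>x\<in>cdom c.
               loc c (\<lambda>p. fh p - f p) x \<in> range (frechet_derivative (loc c f) (at x)) \<and>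
               loc c (\<lambda>p. fh p - f p) x \<in> range (frechet_derivative (loc c fh) (at x))"
    and c2: "\<forall>c\<in>A. \<forall>x\<in>cdom c.
               dim (range (frechet_derivative (\<lambda>y. sgn (loc c (\<lambda>p. fh p - f p) y)) (at x))) = 2"
    and c3: "\<forall>p. dd f fh \<xi> \<xi>h p \<noteq> 0"
    and c4: "\<exists>a b. (\<forall>c\<in>A. \<forall>x\<in>cdom c.
               conormal (loc c f) (loc c \<xi>) x (loc c \<xi>h x) = a \<and>
               conormal (loc c fh) (loc c \<xi>h) x (loc c \<xi> x) = b) \<and> (a \<noteq> 0 \<or> b \<noteq> 0)"
    and c5: "\<forall>c\<in>A. \<forall>x\<in>cdom c.
               (loc c (dd f fh \<xi> \<xi>h) x) ^ 4 * det_theta_h (loc c f) (loc c \<xi>) x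
                 * det_theta_h (loc c fh) (loc c \<xi>h) x
               = (1 - conormal (loc c f) (loc c \<xi>) x (loc c \<xi>h x)
                      * conormal (loc c fh) (loc c \<xi>h) x (loc c \<xi> x)) ^ 4"
    and c6: "\<forall>c\<in>A. \<forall>x\<in>cdom c. \<forall>v.
               det3 (frechet_derivative (loc c f) (at x) v) (loc c \<xi> x) (loc c \<xi>h x)
               = det3 (frechet_derivative (loc c fh) (at x) v) (loc c \<xi> x) (loc c \<xi>h x)"
    and c7: "\<forall>c\<in>A. \<forall>x\<in>cdom c. \<forall>v w.
               frechet_derivative (loc c (dd f fh \<xi> \<xi>h)) (at x) v
                 * frechet_derivative (det_theta_h (loc c f) (loc c \<xi>)) (at x) w
               - frechet_derivative (loc c (dd f fh \<xi> \<xi>h)) (at x) w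
                 * frechet_derivative (det_theta_h (loc c f) (loc c \<xi>)) (at x) v = 0"
    and imR: "\<forall>c\<in>A. \<forall>x\<in>cdom c. dim_im_curv (christ (loc c f) (loc c \<xi>)) x = 2"
             "\<forall>c\<in>A. \<forall>x\<in>cdom c. dim_im_curv (christ (loc c fh) (loc c \<xi>h)) x = 2"
  shows "(\<exists>d. \<forall>p. dd f fh \<xi> \<xi>h p = d)
    \<and> (\<exists>k. \<forall>c\<in>A. \<forall>x\<in>cdom c. det_theta_h (loc c f) (loc c \<xi>) x = k)
    \<and> (\<exists>\<eta>. affine_normal A f \<eta> \<and> (\<forall>p. \<eta> p \<in> span {\<xi> p}))
    \<and> (\<exists>\<eta>. affine_normal A fh \<eta> \<and> (\<forall>p. \<eta> p \<in> span {\<xi>h p}))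
    \<and> (\<exists>Q. pseudo_scalar_product Q
         \<and> (\<forall>c\<in>A. \<forall>x\<in>cdom c. \<forall>v.
               bform Q (loc c \<xi> x) (frechet_derivative (loc c f) (at x) v) = 0 \<and>
               bform Q (loc c \<xi>h x) (frechet_derivative (loc c fh) (at x) v) = 0)
         \<and> (\<exists>a. a \<noteq> 0 \<and> (\<forall>p. bform Q (\<xi> p) (\<xi> p) = a))
         \<and> (\<exists>a. a \<noteq> 0 \<and> (\<forall>p. bform Q (\<xi>h p) (\<xi>h p) = a))
         \<and> (\<exists>a. \<forall>p. bform Q (fh p - f p) (fh p - f p) = a)
         \<and> (\<exists>a. \<forall>p. bform Q (\<xi> p) (\<xi>h p) = a)
         \<and> (\<exists>K. \<forall>c\<in>A. \<forall>x\<in>cdom c.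
               indmet_det Q (loc c f) x \<noteq> 0 \<and> indmet_det Q (loc c fh) x \<noteq> 0 \<and>
               sect_curv Q (loc c f) x = K \<and> sect_curv Q (loc c fh) x = K))"
proof -
  obtain a b where con: "\<And>c x. c \<in> A \<Longrightarrow> x \<in> cdom c \<Longrightarrow> conormal (loc c f) (loc c \<xi>) x (loc c \<xi>h x) = a"
    "\<And>c x. c \<in> A \<Longrightarrow> x \<in> cdom c \<Longrightarrow> conormal (loc c fh) (loc c \<xi>h) x (loc c \<xi> x) = b"
    and ab: "a \<noteq> 0 \<or> b \<noteq> 0" using c4 by blast
  note chart = smooth_atlas_chart[OF atlas]
  have sub: "loc c (\<lambda>p. fh p - f p) = (\<lambda>y. loc c fh y - loc c f y)" for c by (simp add: loc_def fun_eq_iff)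
  have ldd: "loc c (dd f fh \<xi> \<xi>h) = (\<lambda>y. det3 (loc c fh y - loc c f y) (loc c \<xi> y) (loc c \<xi>h y))" for c
    by (simp add: loc_def dd_def fun_eq_iff)
  have smooth: "smooth_on (loc c f) (cdom c)" "smooth_on (loc c fh) (cdom c)" "smooth_on (loc c \<xi>) (cdom c)"
    "smooth_on (loc c \<xi>h) (cdom c)" if "c \<in> A" for c
    using imm eqa that unfolding immersion_def equiaffine_transversal_def smooth_map_def by blast+
  have eqaf: "vol (loc c f) (loc c \<xi>) x \<noteq> 0" "vol (loc c fh) (loc c \<xi>h) x \<noteq> 0"
    "tau (loc c f) (loc c \<xi>) i x = 0" "tau (loc c fh) (loc c \<xi>h) i x = 0" if "c \<in> A" "x \<in> cdom c" for c x i
    using eqa that unfolding equiaffine_transversal_def by blast+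
  have dnz: "det3 (loc c fh y - loc c f y) (loc c \<xi> y) (loc c \<xi>h y) \<noteq> 0" for c y
    using c3 unfolding loc_def dd_def by simp
  have frame: "\<exists>al be ga mu la rh si. backlund_frame (cdom c) (loc c f) (loc c fh) (loc c \<xi>) (loc c \<xi>h) a b al be ga mu la rh si"
    if c: "c \<in> A" and ne: "cdom c \<noteq> {}" for c
  proof (rule backlund_frame_exists[OF chart_facts(1)[OF chart(1)[OF c]] ne smooth[OF c]])
    fix y assume y: "y \<in> cdom c"
    note D = smooth_onD(1)[OF smooth(1)[OF c] y] smooth_onD(1)[OF smooth(2)[OF c] y]
    show "vol (loc c f) (loc c \<xi>) y \<noteq> 0" "vol (loc c fh) (loc c \<xi>h) y \<noteq> 0"
      "\<And>i. tau (loc c f) (loc c \<xi>) i y = 0" "\<And>i. tau (loc c fh) (loc c \<xi>h) i y = 0"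
      using eqaf[OF c y] by blast+
    show "loc c fh y - loc c f y \<in> range (frechet_derivative (loc c f) (at y))"
      "loc c fh y - loc c f y \<in> range (frechet_derivative (loc c fh) (at y))"
      using c1(2) c y unfolding sub by blast+
    show "dim (range (frechet_derivative (\<lambda>y. sgn (loc c fh y - loc c f y)) (at y))) = 2"
      using c2 c y unfolding sub by blast
    show "det3 (loc c fh y - loc c f y) (loc c \<xi> y) (loc c \<xi>h y) \<noteq> 0" by (rule dnz)
    show "conormal (loc c f) (loc c \<xi>) y (loc c \<xi>h y) = a" "conormal (loc c fh) (loc c \<xi>h) y (loc c \<xi> y) = b"
      using con c y by blast+
    show "det3 (pd (loc c f) i y) (loc c \<xi> y) (loc c \<xi>h y) = det3 (pd (loc c fh) i y) (loc c \<xi> y) (loc c \<xi>h y)" for i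
      unfolding pd_def using c6 c y by blast
    show "deth (loc c f) (loc c \<xi>) y \<noteq> 0" using nd(1) c y unfolding nondegenerate_def by blast
    show "det3 (loc c fh y - loc c f y) (loc c \<xi> y) (loc c \<xi>h y) ^ 4 * det_theta_h (loc c f) (loc c \<xi>) y
        * det_theta_h (loc c fh) (loc c \<xi>h) y = (1 - a * b) ^ 4"
      using bspec[OF bspec[OF c5 c] y] unfolding ldd con(1)[OF c y] con(2)[OF c y] .
    show "pd (\<lambda>y. det3 (loc c fh y - loc c f y) (loc c \<xi> y) (loc c \<xi>h y)) 1 y * pd (det_theta_h (loc c f) (loc c \<xi>)) 2 y
      = pd (\<lambda>y. det3 (loc c fh y - loc c f y) (loc c \<xi> y) (loc c \<xi>h y)) 2 y * pd (det_theta_h (loc c f) (loc c \<xi>)) 1 y"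
      using bspec[OF bspec[OF c7 c] y] unfolding ldd pd_def by simp
    show "dim_im_curv (christ (loc c f) (loc c \<xi>)) y = 2" using imR(1) c y by blast
  next
    show "a \<noteq> 0 \<or> b \<noteq> 0" by (rule ab)
  qed
  \<comment> \<open>Any point of the manifold will do: the conditions on the constants
    \<open>a\<close> and \<open>b\<close> are read off in a chart around it.\<close>
  obtain c0 where c0: "c0 \<in> A" "undefined \<in> fst c0" using chart(2) by blast
  define x0 where "x0 = snd c0 undefined"
  have x0: "x0 \<in> cdom c0" unfolding x0_def by (rule chart_facts(2)[OF chart(1)[OF c0(1)] c0(2)])
  have nz: "a \<noteq> 0" "b \<noteq> 0" "1 - a * b \<noteq> 0"
  proof -
    have "cdom c0 \<noteq> {}" using x0 by blast
    then obtain al be ga mu la rh si where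
      "backlund_frame (cdom c0) (loc c0 f) (loc c0 fh) (loc c0 \<xi>) (loc c0 \<xi>h) a b al be ga mu la rh si"
      using frame[OF c0(1)] by blast
    then interpret B: backlund_frame "cdom c0" "loc c0 f" "loc c0 fh" "loc c0 \<xi>" "loc c0 \<xi>h" a b al be ga mu la rh si .
    show "a \<noteq> 0" "b \<noteq> 0" "1 - a * b \<noteq> 0" using B.t_eq[OF x0] B.kap by auto
  qed
  have dl: "loc c (dd f fh \<xi> \<xi>h) differentiable (at x) \<and> (\<forall>i. pd (loc c (dd f fh \<xi> \<xi>h)) i x = 0)
      \<and> det_theta_h (loc c f) (loc c \<xi>) x = (1 - a * b)^2 * (- a / b) / loc c (dd f fh \<xi> \<xi>h) x ^ 2"
    if c: "c \<in> A" and x: "x \<in> cdom c" for c x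
  proof -
    have "cdom c \<noteq> {}" using x by blast
    then obtain al be ga mu la rh si where
      "backlund_frame (cdom c) (loc c f) (loc c fh) (loc c \<xi>) (loc c \<xi>h) a b al be ga mu la rh si"
      using frame[OF c] by blast
    then interpret B: backlund_frame "cdom c" "loc c f" "loc c fh" "loc c \<xi>" "loc c \<xi>h" a b al be ga mu la rh si .
    show ?thesis unfolding ldd using B.diff_dl[OF x] B.pd_dl_zero[OF x] B.det_theta_h_eq[OF x] by blast
  qed
  have "\<exists>d. \<forall>p. dd f fh \<xi> \<xi>h p = d"
    by (rule zero_derivative_constant[OF atlas conn]) (use dl in blast)+
  then obtain d where d: "\<And>p. dd f fh \<xi> \<xi>h p = d" by blast
  have ld: "loc c (dd f fh \<xi> \<xi>h) x = d" for c x by (simp add: loc_def d)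
  have dnz': "d \<noteq> 0" using c3 d by metis
  define k where "k = (1 - a * b)^2 * (- a / b) / d^2"
  have k: "k \<noteq> 0" using nz dnz' by (simp add: k_def)
  have hk: "det_theta_h (loc c f) (loc c \<xi>) x = k" if "c \<in> A" "x \<in> cdom c" for c x
    using dl[OF that] unfolding ld k_def by blast
  \<comment> \<open>The fifth assumption, solved for \<open>det_theta_h\<close> of the second
    surface.\<close>
  define k' where "k' = (1 - a * b)^4 / (d^4 * k)"
  have k': "k' \<noteq> 0" using nz dnz' k by (simp add: k'_def)
  have hk': "det_theta_h (loc c fh) (loc c \<xi>h) x = k'" if "c \<in> A" "x \<in> cdom c" for c x
  proof -
    have "d^4 * k * det_theta_h (loc c fh) (loc c \<xi>h) x = (1 - a * b)^4"
      using bspec[OF bspec[OF c5 that(1)] that(2)] unfolding con(1)[OF that] con(2)[OF that] ld hk[OF that] .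
    then show ?thesis using dnz' k by (simp add: k'_def field_simps)
  qed
  define ad where "ad Q p \<longleftrightarrow> adapted_form a b Q (fh p - f p) (\<xi> p) (\<xi>h p)" for Q p
  \<comment> \<open>Adapted forms are first found only near each point. Being adapted on a whole
    neighbourhood determines the form, so the assignment of the form to the point is well defined
    and locally constant, hence constant on the connected manifold.\<close>
  define germ where "germ Q p \<longleftrightarrow> (\<exists>N. open N \<and> p \<in> N \<and> (\<forall>q\<in>N. ad Q q))" for Q p
  have ad_loc: "adapted_form a b Q (loc c fh y - loc c f y) (loc c \<xi> y) (loc c \<xi>h y)"
    if "ad Q (inv_into (fst c) (snd c) y)" for c Q y
    using that by (simp add: ad_def loc_def)
  have germ_ex: "\<exists>Q. germ Q p" for p
  proof -
    obtain c where c: "c \<in> A" "p \<in> fst c" using chart(2) by blast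
    note ch = chart_facts[OF chart(1)[OF c(1)]]
    have x: "snd c p \<in> cdom c" by (rule ch(2)[OF c(2)])
    then have "cdom c \<noteq> {}" by blast
    then obtain al be ga mu la rh si where
      "backlund_frame (cdom c) (loc c f) (loc c fh) (loc c \<xi>) (loc c \<xi>h) a b al be ga mu la rh si"
      using frame[OF c(1)] by blast
    then interpret B: backlund_frame "cdom c" "loc c f" "loc c fh" "loc c \<xi>" "loc c \<xi>h" a b al be ga mu la rh si .
    obtain Q U where U: "open U" "snd c p \<in> U"
      "\<And>y. y \<in> U \<Longrightarrow> adapted_form a b Q (loc c fh y - loc c f y) (loc c \<xi> y) (loc c \<xi>h y)"
      using B.adapted_form_exists[OF x] by blast
    have "ad Q q" if "q \<in> fst c" "snd c q \<in> U" for q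
      using U(3)[OF that(2)] unfolding ad_def ch(3)[OF that(1)] .
    then have "germ Q p" unfolding germ_def
      using ch(4)[OF U(1)] U(2) c(2) by (intro exI[of _ "{q \<in> fst c. snd c q \<in> U}"]) auto
    then show ?thesis by blast
  qed
  have germ_unique: "Q = Q'" if g: "germ Q p" "germ Q' p" for Q Q' p
  proof -
    obtain N N' where N: "open N" "p \<in> N" "\<And>q. q \<in> N \<Longrightarrow> ad Q q" and N': "open N'" "p \<in> N'" "\<And>q. q \<in> N' \<Longrightarrow> ad Q' q"
      using g unfolding germ_def by blast
    obtain c where c: "c \<in> A" "p \<in> fst c" using chart(2) by blast
    note ch = chart_facts[OF chart(1)[OF c(1)]]
    \<comment> \<open>Both forms are adapted on the common neighbourhood; its image in a chart is an
      open set on which local uniqueness applies.\<close>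
    define U where "U = snd c ` ((N \<inter> N') \<inter> fst c)"
    have U: "open U" "snd c p \<in> U" "U \<subseteq> cdom c"
      unfolding U_def using ch(5)[OF open_Int[OF N(1) N'(1)]] N(2) N'(2) c(2) by (auto simp: cdom_def)
    then have "cdom c \<noteq> {}" by blast
    then obtain al be ga mu la rh si where
      "backlund_frame (cdom c) (loc c f) (loc c fh) (loc c \<xi>) (loc c \<xi>h) a b al be ga mu la rh si"
      using frame[OF c(1)] by blast
    then interpret B: backlund_frame "cdom c" "loc c f" "loc c fh" "loc c \<xi>" "loc c \<xi>h" a b al be ga mu la rh si .
    have inU: "\<exists>q. q \<in> N \<and> q \<in> N' \<and> q \<in> fst c \<and> y = snd c q" if "y \<in> U" for y
      using that unfolding U_def by blast
    have "adapted_form a b Q (loc c fh y - loc c f y) (loc c \<xi> y) (loc c \<xi>h y)"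
      "adapted_form a b Q' (loc c fh y - loc c f y) (loc c \<xi> y) (loc c \<xi>h y)" if y: "y \<in> U" for y
    proof -
      obtain q where q: "q \<in> N" "q \<in> N'" "q \<in> fst c" "y = snd c q" using inU[OF y] by blast
      show "adapted_form a b Q (loc c fh y - loc c f y) (loc c \<xi> y) (loc c \<xi>h y)"
        "adapted_form a b Q' (loc c fh y - loc c f y) (loc c \<xi> y) (loc c \<xi>h y)"
        unfolding q(4) ch(3)[OF q(3)] using N(3)[OF q(1)] N'(3)[OF q(2)] by (simp_all add: ad_def)
    qed
    then show ?thesis by (intro B.adapted_form_unique[OF U]) blast+
  qed
  define QQ where "QQ p = (THE Q. germ Q p)" for p
  have QQ: "germ Q p \<longleftrightarrow> QQ p = Q" for Q p
    unfolding QQ_def using germ_ex[of p] germ_unique by (metis the_equality)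
  have "\<exists>Q. \<forall>p. QQ p = Q"
  proof (rule locally_constant_eq[OF conn])
    fix p
    obtain N where N: "open N" "p \<in> N" "\<And>q. q \<in> N \<Longrightarrow> ad (QQ p) q" using QQ[of "QQ p" p] unfolding germ_def by blast
    have "germ (QQ p) q" if "q \<in> N" for q using N that unfolding germ_def by blast
    then show "\<exists>N. open N \<and> p \<in> N \<and> (\<forall>q\<in>N. QQ q = QQ p)" using N QQ by blast
  qed
  then obtain Q where Q: "\<And>p. germ Q p" using QQ by blast
  have adQ: "ad Q p" for p using Q[of p] unfolding germ_def by blast
  have adL: "\<forall>y\<in>cdom c. adapted_form a b Q (loc c fh y - loc c f y) (loc c \<xi> y) (loc c \<xi>h y)" for c
    using ad_loc[OF adQ] by blast
  note vals = adQ[unfolded ad_def adapted_form_def]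
  have local_facts: "loc c (\<lambda>p. bform Q (fh p - f p) (fh p - f p)) differentiable (at x)
      \<and> (\<forall>i. pd (loc c (\<lambda>p. bform Q (fh p - f p) (fh p - f p))) i x = 0)
      \<and> (\<forall>i. bform Q (loc c \<xi> x) (pd (loc c f) i x) = 0 \<and> bform Q (loc c \<xi>h x) (pd (loc c fh) i x) = 0)
      \<and> indmet_det Q (loc c f) x \<noteq> 0 \<and> indmet_det Q (loc c fh) x \<noteq> 0
      \<and> sect_curv Q (loc c f) x = - (1 - a * b) / bform Q (loc c fh x - loc c f x) (loc c fh x - loc c f x)
      \<and> sect_curv Q (loc c fh) x = - (1 - a * b) / bform Q (loc c fh x - loc c f x) (loc c fh x - loc c f x)"
    if c: "c \<in> A" and x: "x \<in> cdom c" for c x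
  proof -
    have "cdom c \<noteq> {}" using x by blast
    then obtain al be ga mu la rh si where
      "backlund_frame (cdom c) (loc c f) (loc c fh) (loc c \<xi>) (loc c \<xi>h) a b al be ga mu la rh si"
      using frame[OF c] by blast
    then interpret B: backlund_frame "cdom c" "loc c f" "loc c fh" "loc c \<xi>" "loc c \<xi>h" a b al be ga mu la rh si .
    have eq: "loc c (\<lambda>p. bform Q (fh p - f p) (fh p - f p)) = (\<lambda>y. bform Q (loc c fh y - loc c f y) (loc c fh y - loc c f y))"
      by (simp add: loc_def fun_eq_iff)
    show ?thesis
      unfolding eq
      using B.adapted_form_length[OF adL x] B.adapted_form_geometry(1,2)[OF adL x]
        B.adapted_form_curvature[OF adL x eqaf(3,4)[OF c x]] by blast
  qed
  have "\<exists>w. \<forall>p. bform Q (fh p - f p) (fh p - f p) = w"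
    by (rule zero_derivative_constant[OF atlas conn]) (use local_facts in blast)+
  then obtain w where w: "\<And>p. bform Q (fh p - f p) (fh p - f p) = w" by blast
  have orth: "bform Q (loc c \<xi> x) (frechet_derivative (loc c f) (at x) v) = 0 \<and>
      bform Q (loc c \<xi>h x) (frechet_derivative (loc c fh) (at x) v) = 0" if c: "c \<in> A" "x \<in> cdom c" for c x v
    unfolding frechet_derivative_eq_pd[OF smooth_onD(1)[OF smooth(1)[OF c(1)] c(2)]]
      frechet_derivative_eq_pd[OF smooth_onD(1)[OF smooth(2)[OF c(1)] c(2)]]
    using local_facts[OF c] by (simp add: bform_linear(2,6))
  have curv: "indmet_det Q (loc c f) x \<noteq> 0 \<and> indmet_det Q (loc c fh) x \<noteq> 0 \<and>
      sect_curv Q (loc c f) x = - (1 - a * b) / w \<and> sect_curv Q (loc c fh) x = - (1 - a * b) / w"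
    if c: "c \<in> A" "x \<in> cdom c" for c x
  proof -
    have "bform Q (loc c fh x - loc c f x) (loc c fh x - loc c f x) = w" by (simp add: loc_def w)
    then show ?thesis using local_facts[OF c] by simp
  qed
  have psp: "pseudo_scalar_product Q"
    using adapted_form_nondegenerate[OF adQ[unfolded ad_def] nz] c3 unfolding dd_def by blast
  show ?thesis
  proof (intro conjI)
    show "\<exists>d. \<forall>p. dd f fh \<xi> \<xi>h p = d" using d by blast
    show "\<exists>k. \<forall>c\<in>A. \<forall>x\<in>cdom c. det_theta_h (loc c f) (loc c \<xi>) x = k"
      by (intro exI[of _ k] ballI hk)
    show "\<exists>\<eta>. affine_normal A f \<eta> \<and> (\<forall>p. \<eta> p \<in> span {\<xi> p})"
      by (rule affine_normal_exists[OF atlas eqa(1) k hk])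
    show "\<exists>\<eta>. affine_normal A fh \<eta> \<and> (\<forall>p. \<eta> p \<in> span {\<xi>h p})"
      by (rule affine_normal_exists[OF atlas eqa(2) k' hk'])
    have lengths: "1 / (1 - a * b) \<noteq> 0 \<and> (\<forall>p. bform Q (\<xi> p) (\<xi> p) = 1 / (1 - a * b))"
      "a / (b * (1 - a * b)) \<noteq> 0 \<and> (\<forall>p. bform Q (\<xi>h p) (\<xi>h p) = a / (b * (1 - a * b)))"
      "\<forall>p. bform Q (\<xi> p) (\<xi>h p) = a / (1 - a * b)"
      using vals nz by simp_all
    show "\<exists>Q. pseudo_scalar_product Q
         \<and> (\<forall>c\<in>A. \<forall>x\<in>cdom c. \<forall>v.
               bform Q (loc c \<xi> x) (frechet_derivative (loc c f) (at x) v) = 0 \<and>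
               bform Q (loc c \<xi>h x) (frechet_derivative (loc c fh) (at x) v) = 0)
         \<and> (\<exists>a. a \<noteq> 0 \<and> (\<forall>p. bform Q (\<xi> p) (\<xi> p) = a))
         \<and> (\<exists>a. a \<noteq> 0 \<and> (\<forall>p. bform Q (\<xi>h p) (\<xi>h p) = a))
         \<and> (\<exists>a. \<forall>p. bform Q (fh p - f p) (fh p - f p) = a)
         \<and> (\<exists>a. \<forall>p. bform Q (\<xi> p) (\<xi>h p) = a)
         \<and> (\<exists>K. \<forall>c\<in>A. \<forall>x\<in>cdom c.
               indmet_det Q (loc c f) x \<noteq> 0 \<and> indmet_det Q (loc c fh) x \<noteq> 0 \<and>
               sect_curv Q (loc c f) x = K \<and> sect_curv Q (loc c fh) x = K)"
    proof (rule exI[of _ Q], intro conjI)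
      show "pseudo_scalar_product Q" by (rule psp)
      show "\<forall>c\<in>A. \<forall>x\<in>cdom c. \<forall>v. bform Q (loc c \<xi> x) (frechet_derivative (loc c f) (at x) v) = 0 \<and>
          bform Q (loc c \<xi>h x) (frechet_derivative (loc c fh) (at x) v) = 0"
        by (intro ballI allI orth)
      show "\<exists>a. a \<noteq> 0 \<and> (\<forall>p. bform Q (\<xi> p) (\<xi> p) = a)" using lengths(1) by (rule exI)
      show "\<exists>a. a \<noteq> 0 \<and> (\<forall>p. bform Q (\<xi>h p) (\<xi>h p) = a)" using lengths(2) by (rule exI)
      show "\<exists>a. \<forall>p. bform Q (fh p - f p) (fh p - f p) = a" using w by blast
      show "\<exists>a. \<forall>p. bform Q (\<xi> p) (\<xi>h p) = a" using lengths(3) by (rule exI)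
      show "\<exists>K. \<forall>c\<in>A. \<forall>x\<in>cdom c. indmet_det Q (loc c f) x \<noteq> 0 \<and> indmet_det Q (loc c fh) x \<noteq> 0 \<and>
          sect_curv Q (loc c f) x = K \<and> sect_curv Q (loc c fh) x = K"
        by (intro exI[of _ "- (1 - a * b) / w"] ballI curv)
    qed
  qed
qed

end
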